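(* For every $r,k\in\mathbb{N}$ and every $\alpha>0$ there exists a constant $C=C(r,k,\alpha)$, depending only on $r,k,\alpha$, such that the following holds. Let $G$ be a finitely generated group of rank at most $r$. Suppose that either (1) $\mu$ is a symmetric, finitely supported generating probability measure on $G$ with $\mu(\{1\})>0$, and $M=(\mu^{\ast n})_{n=1}^\infty$ is the sequence of measures corresponding to the steps of the random walk on $G$ with respect to $\mu$; or (2) $G$ is amenable and $M=(\mu_n)_{n=1}^\infty$ is an almost-invariant sequence of probability measures on $G$. Suppose that $\mathrm{dc}_M^k(G)\ge\alpha$. Then $G$ has a $k$-step nilpotent subgroup of index at most $C$.
   Context: Groups are discrete. "$G$ has rank at most $r$" means that $G$ can be generated by at most $r$ elements. A group is $k$-step nilpotent if all $(k+1)$-fold simple commutators of its elements are trivial (nilpotent of class at most $k$), where $[x_1,x_2]=x_1^{-1}x_2^{-1}x_1x_2$ and $[x_1,\ldots,x_k]=[[x_1,\ldots,x_{k-1}],x_k]$. For a probability measure $\mu$ on $G$, $\mathrm{dc}^k_\mu(G)$ is the probability that $[x_1,\ldots,x_{k+1}]=1$ when $x_1,\ldots,x_{k+1}$ are chosen independently according to $\mu$. For a sequence $M=(\mu_n)_{n=1}^\infty$ of probability measures, $\mathrm{dc}_M^k(G)=\limsup_{n\to\infty}\mathrm{dc}^k_{\mu_n}(G)$. A probability measure $\mu$ on $G$ is generating if its support generates $G$; symmetric means $\mu(\{x\})=\mu(\{x^{-1}\})$ for all $x$. $\mu^{\ast n}$ denotes the $n$-fold convolution power, i.e. $\mu^{\ast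 n}(x)$ is the probability that a random walk of length $n$ on $G$ (started at $1$, with independent steps distributed according to $\mu$) ends at $x$. A sequence $(\mu_n)_{n=1}^\infty$ of probability measures on $G$ is almost-invariant if $\|x\cdot\mu_n-\mu_n\|_1\to0$ as $n\to\infty$ for every $x\in G$, where $x\cdot\mu(A)=\mu(x^{-1}A)$. *)

theory Defs
  imports "HOL-Probability.Probability" "HOL-Algebra.Algebra"
begin

definition commutator :: "('a, 'b) monoid_scheme \<Rightarrow> 'a \<Rightarrow> 'a \<Rightarrow> 'a" where
  "commutator G x y = inv\<^bsub>G\<^esub> x \<otimes>\<^bsub>G\<^esub> inv\<^bsub>G\<^esub> y \<otimes>\<^bsub>G\<^esub> x \<otimes>\<^bsub>G\<^esub> y"

text \<open>Left-normed: \<open>[x\<^sub>1, \<dots>, x\<^sub>k] = [[x\<^sub>1, \<dots>, x\<^sub>k\<^sub>-\<^sub>1], x\<^sub>k]\<close> and \<open>[x\<^sub>1] = x\<^sub>1\<close>.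
  The value on the empty list is arbitrary and is never used.\<close>

fun simple_commutator :: "('a, 'b) monoid_scheme \<Rightarrow> 'a list \<Rightarrow> 'a" where
  "simple_commutator G [] = \<one>\<^bsub>G\<^esub>"
| "simple_commutator G (x # xs) = foldl (commutator G) x xs"

definition step_nilpotent :: "nat \<Rightarrow> ('a, 'b) monoid_scheme \<Rightarrow> bool" where
  "step_nilpotent k G \<longleftrightarrow>
     (\<forall>xs. set xs \<subseteq> carrier G \<and> length xs = k + 1 \<longrightarrow> simple_commutator G xs = \<one>\<^bsub>G\<^esub>)"

definition rank_at_most :: "('a, 'b) monoid_scheme \<Rightarrow> nat \<Rightarrow> bool" where
  "rank_at_most G r \<longleftrightarrow>
     (\<exists>S. S \<subseteq> carrier G \<and> finite S \<and> card S \<le> r \<and> generate G S = carrier G)"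

definition index_at_most :: "('a, 'b) monoid_scheme \<Rightarrow> 'a set \<Rightarrow> nat \<Rightarrow> bool" where
  "index_at_most G H C \<longleftrightarrow> finite (rcosets\<^bsub>G\<^esub> H) \<and> card (rcosets\<^bsub>G\<^esub> H) \<le> C"

text \<open>A finitely generated group is countable, so a probability measure on it (as a discrete
  group) is the same thing as a \<^typ>\<open>'a pmf\<close> whose support lies in the carrier.\<close>

definition prob_on :: "('a, 'b) monoid_scheme \<Rightarrow> 'a pmf \<Rightarrow> bool" where
  "prob_on G \<mu> \<longleftrightarrow> set_pmf \<mu> \<subseteq> carrier G"

definition generating_pmf :: "('a, 'b) monoid_scheme \<Rightarrow> 'a pmf \<Rightarrow> bool" where
  "generating_pmf G \<mu> \<longleftrightarrow> generate G (set_pmf \<mu>) = carrier G"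

definition symmetric_pmf :: "('a, 'b) monoid_scheme \<Rightarrow> 'a pmf \<Rightarrow> bool" where
  "symmetric_pmf G \<mu> \<longleftrightarrow> (\<forall>x \<in> carrier G. pmf \<mu> x = pmf \<mu> (inv\<^bsub>G\<^esub> x))"

primrec conv_power :: "('a, 'b) monoid_scheme \<Rightarrow> 'a pmf \<Rightarrow> nat \<Rightarrow> 'a pmf" where
  "conv_power G \<mu> 0 = return_pmf \<one>\<^bsub>G\<^esub>"
| "conv_power G \<mu> (Suc n) = map_pmf (\<lambda>(x, y). x \<otimes>\<^bsub>G\<^esub> y) (pair_pmf (conv_power G \<mu> n) \<mu>)"

text \<open>The summand is \<open>|(x \<cdot> \<mu>)({y}) - \<mu>({y})|\<close>, as \<open>(x \<cdot> \<mu>)({y}) = \<mu>(x\<^sup>-\<^sup>1{y})\<close>.\<close>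

definition translate_dist :: "('a, 'b) monoid_scheme \<Rightarrow> 'a \<Rightarrow> 'a pmf \<Rightarrow> real" where
  "translate_dist G x \<mu> = (\<Sum>\<^sub>\<infinity>y \<in> carrier G. \<bar>pmf \<mu> (inv\<^bsub>G\<^esub> x \<otimes>\<^bsub>G\<^esub> y) - pmf \<mu> y\<bar>)"

definition almost_invariant :: "('a, 'b) monoid_scheme \<Rightarrow> (nat \<Rightarrow> 'a pmf) \<Rightarrow> bool" where
  "almost_invariant G M \<longleftrightarrow>
     (\<forall>x \<in> carrier G. (\<lambda>n. translate_dist G x (M n)) \<longlonglongrightarrow> 0)"

text \<open>Amenability of a discrete group: there is a left-invariant, finitely additive probability
  measure defined on all subsets.\<close>

definition amenable :: "('a, 'b) monoid_scheme \<Rightarrow> bool" where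
  "amenable G \<longleftrightarrow>
     (\<exists>m :: 'a set \<Rightarrow> real.
        (\<forall>A. A \<subseteq> carrier G \<longrightarrow> 0 \<le> m A) \<and>
        m (carrier G) = 1 \<and>
        (\<forall>A B. A \<subseteq> carrier G \<and> B \<subseteq> carrier G \<and> A \<inter> B = {} \<longrightarrow> m (A \<union> B) = m A + m B) \<and>
        (\<forall>x \<in> carrier G. \<forall>A. A \<subseteq> carrier G \<longrightarrow> m (x <#\<^bsub>G\<^esub> A) = m A))"

definition dc :: "('a, 'b) monoid_scheme \<Rightarrow> nat \<Rightarrow> 'a pmf \<Rightarrow> real" where
  "dc G k \<mu> =
     measure_pmf.prob (replicate_pmf (k + 1) \<mu>) {xs. simple_commutator G xs = \<one>\<^bsub>G\<^esub>}"

definition dc_limsup :: "('a, 'b) monoid_scheme \<Rightarrow> nat \<Rightarrow> (nat \<Rightarrow> 'a pmf) \<Rightarrow> ereal" where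
  "dc_limsup G k M = limsup (\<lambda>n. ereal (dc G k (M n)))"

text \<open>Sequences \<open>M\<close> are indexed from \<open>0\<close> here, so that \<open>M n\<close> stands for \<open>\<mu>\<^sub>n\<^sub>+\<^sub>1\<close>.\<close>

definition random_walk_case :: "('a, 'b) monoid_scheme \<Rightarrow> (nat \<Rightarrow> 'a pmf) \<Rightarrow> bool" where
  "random_walk_case G M \<longleftrightarrow>
     (\<exists>\<mu>. prob_on G \<mu> \<and> symmetric_pmf G \<mu> \<and> finite (set_pmf \<mu>) \<and> generating_pmf G \<mu> \<and>
          pmf \<mu> \<one>\<^bsub>G\<^esub> > 0 \<and> M = (\<lambda>n. conv_power G \<mu> (Suc n)))"

definition amenable_case :: "('a, 'b) monoid_scheme \<Rightarrow> (nat \<Rightarrow> 'a pmf) \<Rightarrow> bool" where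
  "amenable_case G M \<longleftrightarrow> amenable G \<and> (\<forall>n. prob_on G (M n)) \<and> almost_invariant G M"

definition nilpotent_index_bound ::
    "nat \<Rightarrow> nat \<Rightarrow> real \<Rightarrow> nat \<Rightarrow> ('a, 'b) monoid_scheme \<Rightarrow> bool" where
  "nilpotent_index_bound r k \<alpha> C G \<longleftrightarrow>
     (group G \<and> rank_at_most G r \<longrightarrow>
       (\<forall>M. (random_walk_case G M \<or> amenable_case G M) \<and> dc_limsup G k M \<ge> ereal \<alpha> \<longrightarrow>
         (\<exists>H. subgroup H G \<and> step_nilpotent k (G\<lparr>carrier := H\<rparr>) \<and> index_at_most G H C)))"

text \<open>The constant \<open>C\<close> must not depend on the group, hence also not on the type of its elements,
  but in HOL the type variable of a theorem scopes over an existential quantifier inside it. To say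
  that \<open>C\<close> is uniform over all types one can pin it down on groups with elements in \<^typ>\<open>nat\<close>
  (which represent all finitely generated groups up to isomorphism), and require in addition that
  every constant that works for these groups works for groups over an arbitrary type \<open>'a\<close>:
  \<open>(\<exists>C. \<forall>G :: nat monoid. P C G) \<and> (\<forall>C. (\<forall>G :: nat monoid. P C G) \<longrightarrow> (\<forall>G :: 'a monoid. P C G))\<close>.\<close>

end

theory Submission
  imports Defs
begin

text \<open>
  The measures detect the index of subgroups: for every \<open>\<beta> > 0\<close> and all large \<open>n\<close>, every subgroup
  \<open>H\<close> with \<open>\<mu>\<^sub>n(H) \<ge> \<beta>\<close> has index at most \<open>2/\<beta>\<close>, uniformly in \<open>H\<close>. Indeed the measures of \<open>H\<close> and of
  its translates by a fixed finite set become uniformly close (by almost-invariance, or by the decay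
  of the energy of a symmetric random walk on the Schreier graph of \<open>H\<close>), and since that graph is
  connected, some finite set that does not depend on \<open>H\<close> meets more than \<open>m\<close> cosets of every \<open>H\<close> of
  index more than \<open>m\<close>.

  The theorem then follows by an induction on \<open>k\<close> due to Shalev in the finite case, carried out
  relative to a normal subgroup \<open>N\<close> so that no quotient is formed. If \<open>[x\<^sub>1, \<dots>, x\<^sub>k\<^sub>+\<^sub>2] \<in> N\<close> with
  probability at least \<open>\<alpha>\<close>, then with probability at least \<open>\<alpha>/2\<close> the centralizer of
  \<open>[x\<^sub>1, \<dots>, x\<^sub>k\<^sub>+\<^sub>1]\<close> modulo \<open>N\<close> has measure at least \<open>\<alpha>/2\<close>, hence index at most \<open>m = \<lceil>4/\<alpha>\<rceil>\<close>, hence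
  contains the intersection \<open>\<Gamma>\<close> of all subgroups of index at most \<open>m\<close>, which has index bounded in
  terms of \<open>r\<close> and \<open>m\<close>. Now apply the induction hypothesis to the centralizer of \<open>\<Gamma>\<close> modulo \<open>N\<close>,
  and intersect the resulting subgroup with \<open>\<Gamma>\<close>.
\<close>

section \<open>Subgroups of bounded index\<close>

context group
begin

section \<open>Right cosets and their labellings by natural numbers\<close>

lemma rcos_eq_iff:
  assumes "subgroup H G" "x \<in> carrier G" "y \<in> carrier G"
  shows "H #> x = H #> y \<longleftrightarrow> x \<otimes> inv y \<in> H"
proof
  assume "H #> x = H #> y"
  then have "x \<in> H #> y"
    using rcos_self[OF assms(2,1)] by simp
  then show "x \<otimes> inv y \<in> H"
    using subgroup.rcos_module[OF assms(1) is_group assms(3,2)] by simp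
next
  assume "x \<otimes> inv y \<in> H"
  then have "x \<in> H #> y"
    using subgroup.rcos_module[OF assms(1) is_group assms(3,2)] by simp
  then show "H #> x = H #> y"
    using repr_independence[OF _ assms(3,1)] by simp
qed

lemma mult_inv_cancel:
  assumes "x \<in> carrier G" "y \<in> carrier G"
  shows "x \<otimes> (inv x \<otimes> y) = y" "inv x \<otimes> (x \<otimes> y) = y"
  using assms by (simp_all flip: m_assoc)

lemma rcosets_eq_image: "rcosets H = (\<lambda>x. H #> x) ` carrier G"
  by (auto simp: RCOSETS_def)

text \<open>A chosen preimage of each value of \<open>c\<close> represents a coset, and these
  representatives exhaust the cosets because elements with equal values lie in the same coset. So an
  index is bounded by exhibiting a separating map.\<close>

lemma index_at_mostI:
  assumes "subgroup H G" "finite T" "card T \<le> C" "c ` carrier G \<subseteq> T"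
    and "\<And>x y. \<lbrakk>x \<in> carrier G; y \<in> carrier G; c x = c y\<rbrakk> \<Longrightarrow> x \<otimes> inv y \<in> H"
  shows "index_at_most G H C"
proof -
  have "H #> x = H #> inv_into (carrier G) c (c x)" if "x \<in> carrier G" for x
  proof -
    have "inv_into (carrier G) c (c x) \<in> carrier G" "c (inv_into (carrier G) c (c x)) = c x"
      using that by (simp_all add: inv_into_into f_inv_into_f)
    then show ?thesis
      using that assms(1,5) by (simp add: rcos_eq_iff)
  qed
  then have sub: "rcosets H \<subseteq> (\<lambda>t. H #> inv_into (carrier G) c t) ` T"
    using assms(4) by (auto simp: rcosets_eq_image)
  have "card (rcosets H) \<le> card T"
    using surj_card_le[OF assms(2) sub] .
  then show ?thesis
    unfolding index_at_most_def using finite_surj[OF assms(2) sub] assms(3) by simp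
qed

text \<open>The coset map is composed with a numbering of the cosets. Together with
  \<open>index_at_mostI\<close> this lets index arguments handle numbers attached to group elements
  instead of sets of cosets.\<close>

lemma index_at_most_labelling:
  assumes "subgroup H G" "index_at_most G H C"
  obtains c where "c \<in> carrier G \<rightarrow> {..<C}"
    "\<And>x y. \<lbrakk>x \<in> carrier G; y \<in> carrier G\<rbrakk> \<Longrightarrow> c x = c y \<longleftrightarrow> x \<otimes> inv y \<in> H"
proof -
  obtain h where h: "bij_betw h (rcosets H) {0..<card (rcosets H)}"
    using assms(2) ex_bij_betw_finite_nat unfolding index_at_most_def by blast
  show ?thesis
  proof
    show "(\<lambda>x. h (H #> x)) \<in> carrier G \<rightarrow> {..<C}"
    proof
      fix x assume "x \<in> carrier G"
      then have "h (H #> x) \<in> {0..<card (rcosets H)}"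
        using bij_betwE[OF h] by (auto simp: rcosets_eq_image)
      then show "h (H #> x) \<in> {..<C}"
        using assms(2) unfolding index_at_most_def by auto
    qed
    show "h (H #> x) = h (H #> y) \<longleftrightarrow> x \<otimes> inv y \<in> H" if "x \<in> carrier G" "y \<in> carrier G" for x y
      using h that assms(1)
      by (auto simp: rcos_eq_iff[symmetric] bij_betw_def rcosets_eq_image inj_on_eq_iff)
  qed
qed

text \<open>The pair of the two labels separates the right cosets of the intersection.\<close>

lemma index_at_most_Int:
  assumes "subgroup H G" "index_at_most G H a" "subgroup K G" "index_at_most G K b"
  shows "index_at_most G (H \<inter> K) (a * b)"
proof -
  obtain c where c: "c \<in> carrier G \<rightarrow> {..<a}"
    "\<And>x y. \<lbrakk>x \<in> carrier G; y \<in> carrier G\<rbrakk> \<Longrightarrow> c x = c y \<longleftrightarrow> x \<otimes> inv y \<in> H"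
    using index_at_most_labelling[OF assms(1,2)] by metis
  obtain d where d: "d \<in> carrier G \<rightarrow> {..<b}"
    "\<And>x y. \<lbrakk>x \<in> carrier G; y \<in> carrier G\<rbrakk> \<Longrightarrow> d x = d y \<longleftrightarrow> x \<otimes> inv y \<in> K"
    using index_at_most_labelling[OF assms(3,4)] by metis
  show ?thesis
  proof (rule index_at_mostI[where T = "{..<a} \<times> {..<b}" and c = "\<lambda>x. (c x, d x)"])
    show "subgroup (H \<inter> K) G"
      using assms(1,3) by (rule subgroups_Inter_pair)
    show "(\<lambda>x. (c x, d x)) ` carrier G \<subseteq> {..<a} \<times> {..<b}"
      using c(1) d(1) by (intro image_subsetI) (simp add: Pi_iff)
    show "x \<otimes> inv y \<in> H \<inter> K" if "x \<in> carrier G" "y \<in> carrier G" "(c x, d x) = (c y, d y)" for x y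
      using that c(2)[of x y] d(2)[of x y] by blast
  qed (simp_all add: card_cartesian_product)
qed

lemma index_at_most_Inter:
  assumes "finite F" "F \<noteq> {}" "\<And>H. H \<in> F \<Longrightarrow> subgroup H G \<and> index_at_most G H m"
  shows "index_at_most G (\<Inter>F) (m ^ card F)"
  using assms
proof (induction F rule: finite_ne_induct)
  case (insert H F)
  have "subgroup (\<Inter>F) G"
    by (rule subgroups_Inter) (use insert in auto)
  moreover have "index_at_most G (\<Inter>F) (m ^ card F)"
    using insert by blast
  ultimately have "index_at_most G (H \<inter> \<Inter>F) (m * m ^ card F)"
    using insert.prems[of H] index_at_most_Int by blast
  then show ?case
    using insert by simp
qed auto

text \<open>A subgroup of index at most \<open>m\<close> is recovered from the transition table of the action of the
  generators on its cosets together with the label of the trivial coset.\<close>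

lemma finitely_many_subgroups_of_bounded_index:
  fixes m :: nat
  assumes "rank_at_most G r"
  defines "F \<equiv> {H. subgroup H G \<and> index_at_most G H m}"
  shows "finite F" "card F \<le> m * (m ^ m) ^ (2 * r)"
proof -
  obtain S where S: "S \<subseteq> carrier G" "finite S" "card S \<le> r" "generate G S = carrier G"
    using assms unfolding rank_at_most_def by blast
  define S' where "S' = S \<union> m_inv G ` S"
  have S'c: "S' \<subseteq> carrier G" and S'f: "finite S'"
    using S by (auto simp: S'_def)
  have S'card: "card S' \<le> 2 * r"
    unfolding S'_def using S(3) card_Un_le[of S "m_inv G ` S"] card_image_le[OF S(2), of "m_inv G"]
    by linarith
  have "\<forall>H\<in>F. \<exists>c. c \<in> carrier G \<rightarrow> {..<m} \<and>
    (\<forall>x\<in>carrier G. \<forall>y\<in>carrier G. c x = c y \<longleftrightarrow> x \<otimes> inv y \<in> H)"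
  proof
    fix H assume "H \<in> F"
    then have "subgroup H G" "index_at_most G H m"
      by (auto simp: F_def)
    then obtain c where "c \<in> carrier G \<rightarrow> {..<m}"
      "\<And>x y. \<lbrakk>x \<in> carrier G; y \<in> carrier G\<rbrakk> \<Longrightarrow> c x = c y \<longleftrightarrow> x \<otimes> inv y \<in> H"
      using index_at_most_labelling by metis
    then show "\<exists>c. c \<in> carrier G \<rightarrow> {..<m} \<and>
      (\<forall>x\<in>carrier G. \<forall>y\<in>carrier G. c x = c y \<longleftrightarrow> x \<otimes> inv y \<in> H)"
      by blast
  qed
  then obtain c where c: "\<And>H. H \<in> F \<Longrightarrow> c H \<in> carrier G \<rightarrow> {..<m}"
    "\<And>H x y. \<lbrakk>H \<in> F; x \<in> carrier G; y \<in> carrier G\<rbrakk> \<Longrightarrow> c H x = c H y \<longleftrightarrow> x \<otimes> inv y \<in> H"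
    by metis
  \<comment> \<open>\<open>t H s\<close> records how right multiplication by \<open>s\<close> moves
    coset labels, computed on a chosen representative. Labels that do not occur are fixed, so all
    values stay below \<open>m\<close>; the restrictions to \<open>S'\<close> and
    \<open>{..<m}\<close> place the tables in a finite \<open>PiE\<close> space.\<close>
  define t where "t H = (\<lambda>s\<in>S'. \<lambda>i\<in>{..<m}.
    if i \<in> c H ` carrier G then c H (inv_into (carrier G) (c H) i \<otimes> s) else i)" for H
  have t: "t H s (c H y) = c H (y \<otimes> s)" if "H \<in> F" "s \<in> S'" "y \<in> carrier G" for H s y
  proof -
    define z where "z = inv_into (carrier G) (c H) (c H y)"
    have z: "z \<in> carrier G" "c H z = c H y"
      unfolding z_def using that by (auto intro: inv_into_into f_inv_into_f)
    have s: "s \<in> carrier G"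
      using that S'c by blast
    \<comment> \<open>Right multiplication by \<open>s\<close> respects right cosets, so the choice
      of the representative does not influence the table.\<close>
    have "z \<otimes> inv y \<in> H"
      using c(2) z that by blast
    also have "z \<otimes> inv y = (z \<otimes> s) \<otimes> inv (y \<otimes> s)"
      using z s that by (simp add: inv_mult_group m_assoc mult_inv_cancel)
    finally have "c H (z \<otimes> s) = c H (y \<otimes> s)"
      using c(2) z s that by simp
    moreover have "c H y \<in> {..<m}"
      using c(1) that by blast
    ultimately show ?thesis
      using that by (simp add: t_def z_def)
  qed
  let ?code = "\<lambda>H. (c H \<one>, t H)"
  have inj: "inj_on ?code F"
  proof (rule inj_onI)
    fix H K assume HK: "H \<in> F" "K \<in> F" "?code H = ?code K"
    have step: "c H (y \<otimes> s) = c K (y \<otimes> s)" if "s \<in> S'" "y \<in> carrier G" "c H y = c K y" for s y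
      using t[of H s y] t[of K s y] that HK by simp
    \<comment> \<open>Equal tables keep labels equal along every word in the generators. Starting
      from \<open>\<one>\<close>, where the labels agree, \<open>c H\<close> and \<open>c K\<close>
      coincide on the carrier, and each subgroup consists of the elements with the label of
      \<open>\<one>\<close>.\<close>
    have gen: "\<forall>y\<in>carrier G. c H y = c K y \<longrightarrow> c H (y \<otimes> x) = c K (y \<otimes> x)"
      if "x \<in> generate G S" for x
      using that
    proof induction
      case (eng a b)
      then have "a \<in> carrier G" "b \<in> carrier G"
        using S(4) by auto
      then show ?case
        using eng by (metis m_assoc m_closed)
    qed (use step S'_def in auto)
    have eq: "c H x = c K x" if "x \<in> carrier G" for x
      using gen[of x] that S(4) HK(3) by (metis l_one one_closed prod.inject)
    have sub: "H \<subseteq> carrier G" "K \<subseteq> carrier G"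
      using HK by (auto simp: F_def subgroup_def)
    have "x \<in> H \<longleftrightarrow> x \<in> K" if "x \<in> carrier G" for x
      using c(2)[of H x \<one>] c(2)[of K x \<one>] that HK eq by simp
    then show "H = K"
      using sub by blast
  qed
  let ?T = "{..<m} \<times> (PiE S' (\<lambda>_. PiE {..<m} (\<lambda>_. {..<m})))"
  have t_bound: "t H s i \<in> {..<m}" if "H \<in> F" "s \<in> S'" "i \<in> {..<m}" for H s i
  proof -
    have "c H (inv_into (carrier G) (c H) i \<otimes> s) \<in> {..<m}" if "i \<in> c H ` carrier G"
      using that \<open>H \<in> F\<close> \<open>s \<in> S'\<close> S'c
      by (intro funcset_mem[OF c(1)] m_closed inv_into_into) auto
    then show ?thesis
      using that by (simp add: t_def)
  qed
  have "t H s \<in> PiE {..<m} (\<lambda>_. {..<m})" if "H \<in> F" "s \<in> S'" for H s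
    using t_bound[OF that] that(2) by (intro PiE_I) (simp_all add: t_def)
  moreover have "t H s = undefined" if "s \<notin> S'" for H s
    using that by (simp add: t_def)
  ultimately have "t H \<in> PiE S' (\<lambda>_. PiE {..<m} (\<lambda>_. {..<m}))" if "H \<in> F" for H
    using that by (intro PiE_I) auto
  moreover have "c H \<one> \<in> {..<m}" if "H \<in> F" for H
    by (rule funcset_mem[OF c(1)[OF that]]) simp
  ultimately have sub: "?code ` F \<subseteq> ?T"
    by blast
  have finT: "finite ?T"
    using S'f by (intro finite_cartesian_product finite_PiE) auto
  have "card ?T = m * (m ^ m) ^ card S'"
    using S'f by (simp add: card_cartesian_product card_PiE)
  also have "\<dots> \<le> m * (m ^ m) ^ (2 * r)"
    using S'card by (cases "m = 0") (simp_all add: power_increasing)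
  finally have "card ?T \<le> m * (m ^ m) ^ (2 * r)" .
  then show "card F \<le> m * (m ^ m) ^ (2 * r)"
    using card_inj_on_le[OF inj sub finT] by linarith
  show "finite F"
    using inj_on_finite[OF inj sub finT] .
qed

section \<open>The intersection of all subgroups of bounded index\<close>

definition index_core :: "nat \<Rightarrow> 'a set" where
  "index_core m = \<Inter>{H. subgroup H G \<and> index_at_most G H m}"

lemma index_at_most_carrier: "m > 0 \<Longrightarrow> index_at_most G (carrier G) m"
  by (rule index_at_mostI[of _ "{()}" m "\<lambda>_. ()"]) (auto simp: subgroup_self)

text \<open>For \<open>m > 0\<close> the intersected family contains the whole group. For
  \<open>m = 0\<close> it would be empty, and its intersection would be the whole type instead of a
  subset of the carrier.\<close>

lemma subgroup_index_core: "m > 0 \<Longrightarrow> subgroup (index_core m) G"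
  unfolding index_core_def
  by (rule subgroups_Inter) (use index_at_most_carrier subgroup_self in auto)

text \<open>Intersecting subgroups multiplies the index bounds, and the number of subgroups involved
  is bounded in terms of \<open>r\<close> and \<open>m\<close> only.\<close>

lemma index_index_core:
  assumes "rank_at_most G r" "m > 0"
  shows "index_at_most G (index_core m) (m ^ (m * (m ^ m) ^ (2 * r)))"
proof -
  let ?F = "{H. subgroup H G \<and> index_at_most G H m}"
  have "index_at_most G (index_core m) (m ^ card ?F)"
    unfolding index_core_def
    using finitely_many_subgroups_of_bounded_index[OF assms(1)] index_at_most_carrier[OF assms(2)]
    by (intro index_at_most_Inter) (auto intro: subgroup_self)
  moreover have "m ^ card ?F \<le> m ^ (m * (m ^ m) ^ (2 * r))"
    using finitely_many_subgroups_of_bounded_index[OF assms(1)] assms(2)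
    by (intro power_increasing) auto
  ultimately show ?thesis
    unfolding index_at_most_def by linarith
qed

text \<open>Conjugation by \<open>x\<close> permutes the subgroups of index at most
  \<open>m\<close>: the preimage \<open>?K\<close> of \<open>H\<close> under it is again one of
  them, so it contains \<open>g\<close>.\<close>

lemma index_core_conj:
  assumes "m > 0" "g \<in> index_core m" "x \<in> carrier G"
  shows "x \<otimes> g \<otimes> inv x \<in> index_core m"
  unfolding index_core_def
proof safe
  fix H assume H: "subgroup H G" "index_at_most G H m"
  let ?K = "{g \<in> carrier G. x \<otimes> g \<otimes> inv x \<in> H}"
  have g: "g \<in> carrier G"
    using subgroup.mem_carrier[OF subgroup_index_core[OF assms(1)] assms(2)] .
  have mult: "x \<otimes> (a \<otimes> b) \<otimes> inv x = (x \<otimes> a \<otimes> inv x) \<otimes> (x \<otimes> b \<otimes> inv x)"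
    if "a \<in> carrier G" "b \<in> carrier G" for a b
    using that assms(3) by (simp add: m_assoc mult_inv_cancel)
  have "subgroup ?K G"
  proof (rule subgroup.intro)
    show "\<one> \<in> ?K"
      using H(1) assms(3) by (simp add: subgroup.one_closed)
    show "a \<otimes> b \<in> ?K" if "a \<in> ?K" "b \<in> ?K" for a b
      using that mult[of a b] subgroup.m_closed[OF H(1)] by auto
    show "inv a \<in> ?K" if "a \<in> ?K" for a
      using that subgroup.m_inv_closed[OF H(1), of "x \<otimes> a \<otimes> inv x"] assms(3)
      by (auto simp: inv_mult_group m_assoc)
  qed auto
  moreover obtain c where c: "c \<in> carrier G \<rightarrow> {..<m}"
    "\<And>x y. \<lbrakk>x \<in> carrier G; y \<in> carrier G\<rbrakk> \<Longrightarrow> c x = c y \<longleftrightarrow> x \<otimes> inv y \<in> H"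
    using index_at_most_labelling[OF H] by metis
  have "index_at_most G ?K m"
  \<comment> \<open>The quotient of \<open>x \<otimes> a\<close> by \<open>x \<otimes> b\<close> is
    the conjugate by \<open>x\<close> of \<open>a \<otimes> inv b\<close>, so the
    \<open>H\<close>-labels of the shifted elements separate the cosets of
    \<open>?K\<close>.\<close>
  proof (rule index_at_mostI[where T = "{..<m}" and c = "\<lambda>y. c (x \<otimes> y)"])
    show "a \<otimes> inv b \<in> ?K" if "a \<in> carrier G" "b \<in> carrier G" "c (x \<otimes> a) = c (x \<otimes> b)" for a b
      using that c(2)[of "x \<otimes> a" "x \<otimes> b"] assms(3) by (simp add: inv_mult_group m_assoc)
  qed (use c assms(3) \<open>subgroup ?K G\<close> in auto)
  ultimately have "g \<in> ?K"
    using assms(2) unfolding index_core_def by blast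
  then show "x \<otimes> g \<otimes> inv x \<in> H"
    by simp
qed

text \<open>\<open>B\<close> acts as a ball in the Schreier graphs of all subgroups at once. If
  enlarging the ball by one generator step meets no new coset of \<open>H\<close>, then the cosets
  met are closed under the generators and hence are all cosets; otherwise their number grows by at
  least one.\<close>

lemma finite_set_meeting_many_rcosets:
  assumes "S \<subseteq> carrier G" "finite S" "generate G S = carrier G"
  shows "\<exists>B. finite B \<and> B \<subseteq> carrier G \<and>
    (\<forall>H. subgroup H G \<longrightarrow> \<not> index_at_most G H m \<longrightarrow>
      (\<exists>Y\<subseteq>B. inj_on (\<lambda>y. H #> y) Y \<and> card Y > m))"
proof -
  define S' where "S' = S \<union> m_inv G ` S"
  have S'c: "S' \<subseteq> carrier G" and S'f: "finite S'"
    using assms by (auto simp: S'_def)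
  have "\<exists>B. finite B \<and> B \<subseteq> carrier G \<and>
      (\<forall>H. subgroup H G \<longrightarrow> rcosets H \<subseteq> (\<lambda>y. H #> y) ` B \<or> j < card ((\<lambda>y. H #> y) ` B))" for j
  proof (induction j)
    case 0
    show ?case
      by (intro exI[of _ "{\<one>}"]) auto
  next
    case (Suc j)
    then obtain B where B: "finite B" "B \<subseteq> carrier G"
      "\<And>H. subgroup H G \<Longrightarrow> rcosets H \<subseteq> (\<lambda>y. H #> y) ` B \<or> j < card ((\<lambda>y. H #> y) ` B)"
      by blast
    define B' where "B' = B \<union> (\<lambda>(y, s). y \<otimes> s) ` (B \<times> S')"
    have B': "finite B'" "B' \<subseteq> carrier G" "B \<subseteq> B'"
      using B S'c S'f by (auto simp: B'_def)
    have "rcosets H \<subseteq> (\<lambda>y. H #> y) ` B' \<or> Suc j < card ((\<lambda>y. H #> y) ` B')" if H: "subgroup H G" for H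
    proof (cases "(\<lambda>y. H #> y) ` B' \<subseteq> (\<lambda>y. H #> y) ` B")
      case False
      have "(\<lambda>y. H #> y) ` B \<subset> (\<lambda>y. H #> y) ` B'"
        using False B'(3) by blast
      then have "card ((\<lambda>y. H #> y) ` B) < card ((\<lambda>y. H #> y) ` B')"
        using B' by (intro psubset_card_mono) auto
      moreover have "(\<lambda>y. H #> y) ` B \<subseteq> (\<lambda>y. H #> y) ` B'"
        using B'(3) by (rule image_mono)
      ultimately show ?thesis
        using B(3)[OF H] subset_trans[of "rcosets H" "(\<lambda>y. H #> y) ` B"] less_trans_Suc by blast
    next
      case True
      have hc: "H \<subseteq> carrier G"
        using H by (simp add: subgroup_def)
      let ?R = "(\<lambda>y. H #> y) ` B"
      have step: "H #> (y \<otimes> s) \<in> ?R" if sy: "s \<in> S'" "y \<in> carrier G" "H #> y \<in> ?R" for s y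
      proof -
        obtain b where b: "b \<in> B" "H #> y = H #> b"
          using sy(3) by blast
        have "H #> (y \<otimes> s) = H #> (b \<otimes> s)"
          using coset_mult_assoc[OF hc] sy b B(2) S'c by (metis subsetD)
        moreover have "b \<otimes> s \<in> B'"
          using b sy by (auto simp: B'_def)
        ultimately show ?thesis
          using True by auto
      qed
      have gen: "\<forall>y\<in>carrier G. H #> y \<in> ?R \<longrightarrow> H #> (y \<otimes> x) \<in> ?R" if "x \<in> generate G S" for x
        using that
      proof induction
        case (eng a b)
        then have "a \<in> carrier G" "b \<in> carrier G"
          using assms(3) by auto
        then show ?case
          using eng by (metis m_assoc m_closed)
      qed (use step S'_def in auto)
      show ?thesis
      proof (cases "B = {}")
        case True
        then show ?thesis
          using B(3)[OF H] by (auto simp: rcosets_eq_image)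
      next
        case False
        then obtain b where b: "b \<in> B"
          by blast
        have "H #> x \<in> ?R" if "x \<in> carrier G" for x
        proof -
          have bG: "b \<in> carrier G"
            using b B(2) by blast
          then have "H #> (b \<otimes> (inv b \<otimes> x)) \<in> ?R"
            using gen[of "inv b \<otimes> x"] b that assms(3) by auto
          then show ?thesis
            using bG that by (simp add: mult_inv_cancel)
        qed
        then have "rcosets H \<subseteq> (\<lambda>y. H #> y) ` B'"
          using image_mono[OF B'(3), of "\<lambda>y. H #> y"] by (auto simp: rcosets_eq_image)
        then show ?thesis ..
      qed
    qed
    then show ?case
      using B' by blast
  qed
  then obtain B where B: "finite B" "B \<subseteq> carrier G"
    "\<And>H. subgroup H G \<Longrightarrow> rcosets H \<subseteq> (\<lambda>y. H #> y) ` B \<or> m < card ((\<lambda>y. H #> y) ` B)"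
    by metis
  have "\<exists>Y\<subseteq>B. inj_on (\<lambda>y. H #> y) Y \<and> card Y > m"
    if H: "subgroup H G" "\<not> index_at_most G H m" for H
  proof -
    \<comment> \<open>If the cosets met by \<open>B\<close> are all the cosets of \<open>H\<close>,
      they are finite in number, and more than \<open>m\<close> because the index bound
      fails.\<close>
    have "m < card ((\<lambda>y. H #> y) ` B)"
    proof (cases "rcosets H \<subseteq> (\<lambda>y. H #> y) ` B")
      case True
      then have "rcosets H = (\<lambda>y. H #> y) ` B"
        using B(2) by (auto simp: rcosets_eq_image)
      then show ?thesis
        using H(2) B(1) unfolding index_at_most_def by simp
    qed (use B(3)[OF H(1)] in blast)
    moreover obtain Y where "Y \<subseteq> B" "inj_on (\<lambda>y. H #> y) Y" "(\<lambda>y. H #> y) ` B = (\<lambda>y. H #> y) ` Y"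
      by (metis subset_image_inj order_refl)
    ultimately show ?thesis
      by (metis card_image)
  qed
  with B(1,2) show ?thesis
    by blast
qed

end

section \<open>Energy decay of reversible random walks\<close>

lemma summable_on_diff:
  fixes f g :: "'v \<Rightarrow> real"
  assumes "f summable_on V" "g summable_on V"
  shows "(\<lambda>K. f K - g K) summable_on V"
  using summable_on_add[OF assms(1), of "\<lambda>K. - g K"] assms(2) by (simp add: summable_on_uminus)

lemma infsum_diff:
  fixes f g :: "'v \<Rightarrow> real"
  assumes "f summable_on V" "g summable_on V"
  shows "(\<Sum>\<^sub>\<infinity>K\<in>V. f K - g K) = infsum f V - infsum g V"
  using infsum_add[OF assms(1), of "\<lambda>K. - g K"] assms(2) by (simp add: summable_on_uminus infsum_uminus)

lemma has_sum_sum_real: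
  fixes g :: "'s \<Rightarrow> 'v \<Rightarrow> real"
  assumes "finite S" "\<And>s. s \<in> S \<Longrightarrow> (g s has_sum c s) V"
  shows "((\<lambda>K. \<Sum>s\<in>S. g s K) has_sum (\<Sum>s\<in>S. c s)) V"
  using assms
proof (induction S rule: finite_induct)
  case (insert s S)
  then have "((\<lambda>K. g s K + (\<Sum>s\<in>S. g s K)) has_sum (c s + (\<Sum>s\<in>S. c s))) V"
    by (intro has_sum_add) simp_all
  with insert.hyps show ?case
    by simp
qed simp

lemma summable_on_sum_real:
  fixes g :: "'s \<Rightarrow> 'v \<Rightarrow> real"
  assumes "finite S" "\<And>s. s \<in> S \<Longrightarrow> g s summable_on V"
  shows "(\<lambda>K. \<Sum>s\<in>S. g s K) summable_on V"
  by (rule has_sum_imp_summable, rule has_sum_sum_real[where c = "\<lambda>s. infsum (g s) V"])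
    (simp_all add: assms)

lemma infsum_sum_real:
  fixes g :: "'s \<Rightarrow> 'v \<Rightarrow> real"
  assumes "finite S" "\<And>s. s \<in> S \<Longrightarrow> g s summable_on V"
  shows "(\<Sum>\<^sub>\<infinity>K\<in>V. \<Sum>s\<in>S. g s K) = (\<Sum>s\<in>S. infsum (g s) V)"
  by (rule infsumI, rule has_sum_sum_real) (simp_all add: assms)

text \<open>The energies \<open>E n = \<Sum>\<^sub>\<infinity>K\<in>V. (f n K)\<^sup>2\<close> of a reversible random walk form a convex
  sequence, because \<open>E n - 2 * E (n + 1) + E (n + 2)\<close> is the squared norm of \<open>f n - f (n + 2)\<close>. Hence
  \<open>(n + 1) * (E n - E (n + 1)) \<le> E 0\<close>, while \<open>E n - E (n + 1)\<close> is the sum over \<open>K\<close> of the variance of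
  \<open>f n (T s K)\<close> for \<open>s\<close> distributed according to \<open>w\<close>.\<close>

lemma energy_decay:
  fixes V :: "'v set" and T :: "'s \<Rightarrow> 'v \<Rightarrow> 'v" and w :: "'s \<Rightarrow> real" and f :: "nat \<Rightarrow> 'v \<Rightarrow> real"
  assumes S: "finite S" "\<And>s. s \<in> S \<Longrightarrow> w s \<ge> 0" "sum w S = 1"
    and i: "\<And>s. s \<in> S \<Longrightarrow> i s \<in> S" "\<And>s. s \<in> S \<Longrightarrow> i (i s) = s" "\<And>s. s \<in> S \<Longrightarrow> w (i s) = w s"
    and T: "\<And>s. s \<in> S \<Longrightarrow> bij_betw (T s) V V" "\<And>s K. \<lbrakk>s \<in> S; K \<in> V\<rbrakk> \<Longrightarrow> T (i s) (T s K) = K"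
    and f0: "v0 \<in> V" "\<And>K. K \<in> V \<Longrightarrow> f 0 K = (if K = v0 then 1 else 0)"
    and fSuc: "\<And>n K. K \<in> V \<Longrightarrow> f (Suc n) K = (\<Sum>s\<in>S. w s * f n (T s K))"
    and "s \<in> S" "K \<in> V"
  shows "real (Suc n) * (w s * (f n (T s K) - f (Suc n) K)\<^sup>2) \<le> 1"
proof -
  have TV: "T s K \<in> V" if "s \<in> S" "K \<in> V" for s K
    using T(1) that bij_betwE by blast
  \<comment> \<open>Each step of the walk preserves finite support, which yields the summability of
    all the products summed below.\<close>
  have fin: "finite {K \<in> V. f n K \<noteq> 0}" for n
  proof (induction n)
    case 0
    have "{K \<in> V. f 0 K \<noteq> 0} \<subseteq> {v0}"
      using f0 by (auto split: if_splits)
    then show ?case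
      using finite_subset by blast
  next
    case (Suc n)
    have "{K \<in> V. f (Suc n) K \<noteq> 0} \<subseteq> (\<Union>s\<in>S. T (i s) ` {K \<in> V. f n K \<noteq> 0})"
    proof
      fix K assume K: "K \<in> {K \<in> V. f (Suc n) K \<noteq> 0}"
      then have "(\<Sum>s\<in>S. w s * f n (T s K)) \<noteq> 0"
        using fSuc[of K n] by simp
      then obtain s where s: "s \<in> S" "f n (T s K) \<noteq> 0"
        by (elim sum.not_neutral_contains_not_neutral) auto
      then have "T s K \<in> {K \<in> V. f n K \<noteq> 0}" "T (i s) (T s K) = K"
        using K TV T(2) by auto
      then show "K \<in> (\<Union>s\<in>S. T (i s) ` {K \<in> V. f n K \<noteq> 0})"
        using s(1) by force
    qed
    then show ?case
      using S(1) Suc finite_subset by blast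
  qed
  have finT: "finite {K \<in> V. f n (T s K) \<noteq> 0}" if "s \<in> S" for n s
  proof -
    have "{K \<in> V. f n (T s K) \<noteq> 0} \<subseteq> T (i s) ` {K \<in> V. f n K \<noteq> 0}"
      using TV T(2) that by force
    then show ?thesis
      using fin finite_subset by blast
  qed
  have summ: "(\<lambda>K. f a K * g K) summable_on V" for a g
    by (rule finite_nonzero_values_imp_summable_on, rule finite_subset[OF _ fin[of a]]) auto
  have summT: "(\<lambda>K. f a (T s K) * g K) summable_on V" if "s \<in> S" for a s g
    by (rule finite_nonzero_values_imp_summable_on, rule finite_subset[OF _ finT[OF that, of a]]) auto
  define D where "D a b = (\<Sum>\<^sub>\<infinity>K\<in>V. f a K * f b K)" for a b
  have D_Suc: "D (Suc a) b = (\<Sum>s\<in>S. w s * (\<Sum>\<^sub>\<infinity>K\<in>V. f a (T s K) * f b K))" for a b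
  proof -
    have "D (Suc a) b = (\<Sum>\<^sub>\<infinity>K\<in>V. \<Sum>s\<in>S. w s * (f a (T s K) * f b K))"
      unfolding D_def by (intro infsum_cong) (simp add: fSuc sum_distrib_right mult.assoc)
    also have "\<dots> = (\<Sum>s\<in>S. \<Sum>\<^sub>\<infinity>K\<in>V. w s * (f a (T s K) * f b K))"
      by (intro infsum_sum_real S(1) summable_on_cmult_right summT)
    finally show ?thesis
      by (simp add: infsum_cmult_right')
  qed
  \<comment> \<open>The averaging operator is self-adjoint: substitute \<open>T s K\<close> for
    \<open>K\<close>, then exchange \<open>s\<close> with \<open>i s\<close>, which has the same
    weight. Consequently \<open>D a (Suc (Suc a))\<close> is the energy
    \<open>E (Suc a)\<close>.\<close>
  have D_shift: "D (Suc a) b = D a (Suc b)" for a b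
  proof -
    have "(\<Sum>\<^sub>\<infinity>K\<in>V. f a (T s K) * f b K) = (\<Sum>\<^sub>\<infinity>K\<in>V. f b (T (i s) K) * f a K)" if "s \<in> S" for s
    proof -
      have "(\<Sum>\<^sub>\<infinity>K\<in>V. f a (T s K) * f b K) = (\<Sum>\<^sub>\<infinity>K\<in>V. f b (T (i s) (T s K)) * f a (T s K))"
        using T(2)[OF that] by (intro infsum_cong) simp
      also have "\<dots> = (\<Sum>\<^sub>\<infinity>K\<in>V. f b (T (i s) K) * f a K)"
        by (rule infsum_reindex_bij_betw[OF T(1)[OF that]])
      finally show ?thesis .
    qed
    then have "D (Suc a) b = (\<Sum>s\<in>S. w (i s) * (\<Sum>\<^sub>\<infinity>K\<in>V. f b (T (i s) K) * f a K))"
      unfolding D_Suc using i(3) by (intro sum.cong) auto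
    also have "\<dots> = (\<Sum>s\<in>S. w s * (\<Sum>\<^sub>\<infinity>K\<in>V. f b (T s K) * f a K))"
      by (rule sum.reindex_bij_witness[where i = i and j = i]) (use i in auto)
    also have "\<dots> = D a (Suc b)"
      unfolding D_Suc[symmetric] by (simp add: D_def mult.commute)
    finally show ?thesis .
  qed
  define E where "E a = D a a" for a
  define d where "d a = E a - E (Suc a)" for a
  have d_sum: "d a = (\<Sum>\<^sub>\<infinity>K\<in>V. \<Sum>s\<in>S. w s * (f a (T s K) - f (Suc a) K)\<^sup>2)"
    and d_summable: "(\<lambda>K. \<Sum>s\<in>S. w s * (f a (T s K) - f (Suc a) K)\<^sup>2) summable_on V" for a
  proof -
    have var: "(\<Sum>s\<in>S. w s * (f a (T s K) - f (Suc a) K)\<^sup>2)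
      = (\<Sum>s\<in>S. w s * (f a (T s K) * f a (T s K))) - f (Suc a) K * f (Suc a) K" if "K \<in> V" for K
    proof -
      have "(\<Sum>s\<in>S. w s * (f a (T s K) - f (Suc a) K)\<^sup>2)
        = (\<Sum>s\<in>S. w s * (f a (T s K) * f a (T s K))) - 2 * f (Suc a) K * (\<Sum>s\<in>S. w s * f a (T s K))
          + sum w S * (f (Suc a) K * f (Suc a) K)"
        by (simp add: sum_distrib_left sum_distrib_right power2_eq_square algebra_simps
            sum.distrib sum_subtractf)
      then show ?thesis
        using fSuc[OF that, of a] S(3) by simp
    qed
    have s1: "(\<lambda>K. \<Sum>s\<in>S. w s * (f a (T s K) * f a (T s K))) summable_on V"
      by (intro summable_on_sum_real S(1) summable_on_cmult_right summT)
    have s2: "(\<lambda>K. (\<Sum>s\<in>S. w s * (f a (T s K) * f a (T s K))) - f (Suc a) K * f (Suc a) K) summable_on V"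
      using s1 summ by (rule summable_on_diff)
    show "(\<lambda>K. \<Sum>s\<in>S. w s * (f a (T s K) - f (Suc a) K)\<^sup>2) summable_on V"
      using s2 by (subst summable_on_cong[OF var]) auto
    have "(\<Sum>\<^sub>\<infinity>K\<in>V. \<Sum>s\<in>S. w s * (f a (T s K) * f a (T s K)))
      = (\<Sum>s\<in>S. w s * (\<Sum>\<^sub>\<infinity>K\<in>V. f a (T s K) * f a (T s K)))"
      by (subst infsum_sum_real[OF S(1)]) (auto intro: summable_on_cmult_right summT simp: infsum_cmult_right')
    also have "\<dots> = (\<Sum>s\<in>S. w s * E a)"
      unfolding E_def D_def
      by (intro sum.cong refl arg_cong2[where f = "(*)"] infsum_reindex_bij_betw T(1))
    also have "\<dots> = E a"
      using S(3) by (simp flip: sum_distrib_right)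
    finally have "d a = (\<Sum>\<^sub>\<infinity>K\<in>V. (\<Sum>s\<in>S. w s * (f a (T s K) * f a (T s K))))
      - (\<Sum>\<^sub>\<infinity>K\<in>V. f (Suc a) K * f (Suc a) K)"
      by (simp add: d_def E_def D_def)
    also have "\<dots> = (\<Sum>\<^sub>\<infinity>K\<in>V. (\<Sum>s\<in>S. w s * (f a (T s K) * f a (T s K))) - f (Suc a) K * f (Suc a) K)"
      using s1 summ by (rule infsum_diff[symmetric])
    also have "\<dots> = (\<Sum>\<^sub>\<infinity>K\<in>V. \<Sum>s\<in>S. w s * (f a (T s K) - f (Suc a) K)\<^sup>2)"
      by (rule infsum_cong) (rule var[symmetric])
    finally show "d a = (\<Sum>\<^sub>\<infinity>K\<in>V. \<Sum>s\<in>S. w s * (f a (T s K) - f (Suc a) K)\<^sup>2)" .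
  qed
  have "d (Suc a) \<le> d a" for a
  proof -
    have "0 \<le> (\<Sum>\<^sub>\<infinity>K\<in>V. (f a K - f (Suc (Suc a)) K)\<^sup>2)"
      by (intro infsum_nonneg) simp
    also have "\<dots> = (\<Sum>\<^sub>\<infinity>K\<in>V. f a K * f a K - 2 * (f a K * f (Suc (Suc a)) K)
      + f (Suc (Suc a)) K * f (Suc (Suc a)) K)"
      by (intro infsum_cong) (simp add: power2_eq_square algebra_simps)
    also have "\<dots> = E a - 2 * D a (Suc (Suc a)) + E (Suc (Suc a))"
      unfolding E_def D_def
      by (simp add: infsum_add infsum_diff infsum_cmult_right'
          summable_on_diff summable_on_cmult_right summ)
    also have "D a (Suc (Suc a)) = E (Suc a)"
      unfolding E_def by (simp add: D_shift)
    finally show ?thesis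
      by (simp add: d_def)
  qed
  then have d_anti: "decseq d"
    by (rule decseq_SucI)
  have "real (Suc n) * d n = (\<Sum>a<Suc n. d n)"
    by simp
  also have "\<dots> \<le> (\<Sum>a<Suc n. d a)"
    using d_anti by (intro sum_mono) (auto simp: decseq_def)
  also have "\<dots> = E 0 - E (Suc n)"
    unfolding d_def by (rule sum_lessThan_telescope')
  also have "\<dots> \<le> E 0"
    by (simp add: E_def D_def infsum_nonneg)
  also have "E 0 = 1"
  proof -
    have "E 0 = (\<Sum>\<^sub>\<infinity>K\<in>{v0}. 1)"
      unfolding E_def D_def using f0 by (intro infsum_cong_neutral) auto
    then show ?thesis
      by simp
  qed
  finally have "real (Suc n) * d n \<le> 1" .
  \<comment> \<open>By \<open>d_sum\<close>, \<open>d n\<close> is a sum of nonnegative terms, one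
    of which is the left side.\<close>
  moreover have "w s * (f n (T s K) - f (Suc n) K)\<^sup>2 \<le> d n"
  proof -
    have "w s * (f n (T s K) - f (Suc n) K)\<^sup>2 \<le> (\<Sum>s\<in>S. w s * (f n (T s K) - f (Suc n) K)\<^sup>2)"
      using S(1,2) \<open>s \<in> S\<close> by (intro member_le_sum) auto
    also have "\<dots> = sum (\<lambda>K. \<Sum>s\<in>S. w s * (f n (T s K) - f (Suc n) K)\<^sup>2) {K}"
      by simp
    also have "\<dots> \<le> d n"
      unfolding d_sum using d_summable \<open>K \<in> V\<close> S(2)
      by (intro finite_sum_le_infsum) (auto intro!: sum_nonneg)
    finally show ?thesis .
  qed
  ultimately show ?thesis
    by (smt (verit) mult_left_mono of_nat_0_le_iff)
qed

section \<open>Uniform detection of index\<close>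

lemma summable_on_pmf: "pmf p summable_on A"
  by (rule abs_summable_summable) (subst abs_summable_equivalent, rule pmf_abs_summable)

lemma measure_pmf_infsum: "measure (measure_pmf p) A = (\<Sum>\<^sub>\<infinity>x\<in>A. pmf p x)"
  by (simp add: measure_pmf_conv_infsetsum infsetsum_infsum pmf_abs_summable)

lemma measure_bind_pmf: "measure (measure_pmf (bind_pmf p f)) A = (\<integral>x. measure (measure_pmf (f x)) A \<partial>measure_pmf p)"
  unfolding measure_pmf_bind
  by (rule measure_pmf.measure_bind[where N = "count_space UNIV"])
    (auto simp: space_subprob_algebra measure_pmf.subprob_space_axioms)

lemma measure_pmf_Int_supset: "set_pmf p \<subseteq> B \<Longrightarrow> measure (measure_pmf p) (A \<inter> B) = measure (measure_pmf p) A"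
  by (intro measure_pmf.finite_measure_eq_AE) (auto simp: AE_measure_pmf_iff)

context group
begin

text \<open>It is essential that the threshold for \<open>n\<close> does not depend on \<open>H\<close>.\<close>

definition detects_index :: "(nat \<Rightarrow> 'a pmf) \<Rightarrow> bool" where
  "detects_index M \<longleftrightarrow> (\<forall>\<beta>>0. \<forall>\<^sub>F n in sequentially. \<forall>H. subgroup H G \<and> \<beta> \<le> measure (M n) H \<longrightarrow>
     index_at_most G H (nat \<lceil>2 / \<beta>\<rceil>))"

text \<open>\<open>A H y\<close> stands for \<open>H y\<close> or \<open>y\<^sup>-\<^sup>1 H\<close>; both are indexed by the right cosets of \<open>H\<close>.\<close>

lemma detects_indexI:
  fixes M :: "nat \<Rightarrow> 'a pmf"
  assumes "rank_at_most G r"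
    and disj: "\<And>H y z. \<lbrakk>subgroup H G; y \<in> carrier G; z \<in> carrier G; A H y \<inter> A H z \<noteq> {}\<rbrakk> \<Longrightarrow> H #> y = H #> z"
    and near: "\<And>y \<epsilon>. \<lbrakk>y \<in> carrier G; \<epsilon> > 0\<rbrakk> \<Longrightarrow>
      \<forall>\<^sub>F n in sequentially. \<forall>H. subgroup H G \<longrightarrow> measure (M n) H - \<epsilon> \<le> measure (M n) (A H y)"
  shows "detects_index M"
  unfolding detects_index_def
proof (intro allI impI)
  fix \<beta> :: real assume \<beta>: "\<beta> > 0"
  obtain S where S: "S \<subseteq> carrier G" "finite S" "generate G S = carrier G"
    using assms(1) unfolding rank_at_most_def by blast
  \<comment> \<open>More than \<open>m\<close> disjoint sets of measure at least
    \<open>\<beta> / 2\<close> would have total measure greater than 1.\<close>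
  define m where "m = nat \<lceil>2 / \<beta>\<rceil>"
  obtain B where B: "finite B" "B \<subseteq> carrier G"
    "\<And>H. \<lbrakk>subgroup H G; \<not> index_at_most G H m\<rbrakk> \<Longrightarrow> \<exists>Y\<subseteq>B. inj_on (\<lambda>y. H #> y) Y \<and> card Y > m"
    using finite_set_meeting_many_rcosets[OF S, of m] by blast
  \<comment> \<open>\<open>B\<close> is finite and was chosen before \<open>H\<close>, so the
    thresholds for its elements combine into one that serves all subgroups.\<close>
  have "\<forall>\<^sub>F n in sequentially. \<forall>y\<in>B. \<forall>H. subgroup H G \<longrightarrow>
      measure (M n) H - \<beta> / 2 \<le> measure (M n) (A H y)"
    by (rule eventually_ball_finite[OF B(1)], rule ballI, rule near) (use B(2) \<beta> in auto)
  then have "\<forall>\<^sub>F n in sequentially. \<forall>H. subgroup H G \<and> \<beta> \<le> measure (M n) H \<longrightarrow> index_at_most G H m"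
  proof (rule eventually_mono)
    fix n
    assume elim: "\<forall>y\<in>B. \<forall>H. subgroup H G \<longrightarrow> measure (M n) H - \<beta> / 2 \<le> measure (M n) (A H y)"
    show "\<forall>H. subgroup H G \<and> \<beta> \<le> measure (M n) H \<longrightarrow> index_at_most G H m"
    proof (intro allI impI)
      fix H
      assume H: "subgroup H G \<and> \<beta> \<le> measure (M n) H"
      show "index_at_most G H m"
      proof (rule ccontr)
        assume "\<not> index_at_most G H m"
        then have "\<exists>Y\<subseteq>B. inj_on (\<lambda>y. H #> y) Y \<and> card Y > m"
          using B(3)[of H] H by simp
        then obtain Y where Y: "Y \<subseteq> B" "inj_on (\<lambda>y. H #> y) Y" "card Y > m"
          by blast
        have finY: "finite Y"
          using Y(1) B(1) finite_subset by blast
        have "disjoint_family_on (A H) Y"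
          unfolding disjoint_family_on_def
        proof (intro ballI impI, rule ccontr)
          fix y z assume yz: "y \<in> Y" "z \<in> Y" "y \<noteq> z" "A H y \<inter> A H z \<noteq> {}"
          then have "H #> y = H #> z"
            using disj[of H y z] H Y(1) B(2) by blast
          then show False
            using yz Y(2) by (auto dest: inj_onD)
        qed
        have "2 / \<beta> \<le> real m"
          unfolding m_def using \<beta> by linarith
        then have "1 \<le> real m * (\<beta> / 2)"
          using \<beta> by (simp add: field_simps)
        also have "\<dots> < real (card Y) * (\<beta> / 2)"
          using Y(3) \<beta> by simp
        also have "\<dots> = (\<Sum>y\<in>Y. \<beta> / 2)"
          by simp
        also have "\<dots> \<le> (\<Sum>y\<in>Y. measure (M n) (A H y))"
        proof (rule sum_mono)
          fix y assume "y \<in> Y"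
          then have "measure (M n) H - \<beta> / 2 \<le> measure (M n) (A H y)"
            using elim H Y(1) by blast
          then show "\<beta> / 2 \<le> measure (M n) (A H y)"
            using H by linarith
        qed
        also have "\<dots> = measure (M n) (\<Union>y\<in>Y. A H y)"
          using finY \<open>disjoint_family_on (A H) Y\<close>
          by (intro measure_pmf.finite_measure_finite_Union[symmetric]) auto
        also have "\<dots> \<le> 1"
          by simp
        finally show False
          by simp
      qed
    qed
  qed
  then show "\<forall>\<^sub>F n in sequentially. \<forall>H. subgroup H G \<and> \<beta> \<le> measure (M n) H \<longrightarrow>
     index_at_most G H (nat \<lceil>2 / \<beta>\<rceil>)"
    by (simp only: m_def)
qed

text \<open>The measure of \<open>inv y <# H\<close> is that of \<open>H\<close> under the translate
  of \<open>M n\<close> by \<open>y\<close>, so it falls below the measure of \<open>H\<close> by at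
  most \<open>translate_dist G y (M n)\<close>, a bound free of \<open>H\<close>. Inversion matches
  these left cosets with the right cosets \<open>H #> y\<close>.\<close>

lemma almost_invariant_detects_index:
  assumes "rank_at_most G r" "almost_invariant G M"
  shows "detects_index M"
proof (rule detects_indexI[OF assms(1), where A = "\<lambda>H y. inv y <# H"])
  fix H y z
  assume H: "subgroup H G" and yz: "y \<in> carrier G" "z \<in> carrier G"
    and "(inv y <# H) \<inter> (inv z <# H) \<noteq> {}"
  then obtain a b where ab: "a \<in> H" "b \<in> H" "inv y \<otimes> a = inv z \<otimes> b"
    by (auto simp: l_coset_def)
  then have c: "a \<in> carrier G" "b \<in> carrier G"
    using H by (auto dest: subgroup.mem_carrier)
  have "y \<otimes> inv z = y \<otimes> (inv z \<otimes> b) \<otimes> inv b"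
    using c yz by (simp add: m_assoc)
  also have "\<dots> = y \<otimes> (inv y \<otimes> a) \<otimes> inv b"
    using ab by simp
  also have "\<dots> = a \<otimes> inv b"
    using c yz by (simp add: mult_inv_cancel)
  finally show "H #> y = H #> z"
    using ab H yz by (simp add: rcos_eq_iff subgroup.m_closed subgroup.m_inv_closed)
next
  fix y and \<epsilon> :: real
  assume y: "y \<in> carrier G" and \<epsilon>: "\<epsilon> > 0"
  have bound: "measure (M n) H - translate_dist G y (M n) \<le> measure (M n) (inv y <# H)"
    if H: "subgroup H G" for n H
  proof -
    let ?p = "pmf (M n)"
    have Hc: "H \<subseteq> carrier G"
      using H by (simp add: subgroup_def)
    have inj: "inj_on (\<lambda>z. inv y \<otimes> z) (carrier G)"
      using y by (intro inj_onI) simp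
    have s: "(\<lambda>z. ?p (inv y \<otimes> z)) summable_on carrier G"
      using summable_on_reindex[OF inj, of ?p] summable_on_pmf[of "M n"] by (simp add: o_def)
    have "(\<lambda>z. ?p (inv y \<otimes> z) - ?p z) summable_on carrier G"
      using s summable_on_pmf by (rule summable_on_diff)
    then have sabs: "(\<lambda>z. \<bar>?p (inv y \<otimes> z) - ?p z\<bar>) summable_on carrier G"
      using summable_on_iff_abs_summable_on_real[of "\<lambda>z. ?p (inv y \<otimes> z) - ?p z"] by simp
    have sH: "(\<lambda>z. ?p (inv y \<otimes> z)) summable_on H"
      using s Hc by (rule summable_on_subset_banach)
    have "inv y <# H = (\<lambda>z. inv y \<otimes> z) ` H"
      by (auto simp: l_coset_def)
    then have "measure (M n) (inv y <# H) = (\<Sum>\<^sub>\<infinity>z\<in>H. ?p (inv y \<otimes> z))"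
      using infsum_reindex[OF inj_on_subset[OF inj Hc], of ?p] by (simp add: measure_pmf_infsum o_def)
    then have "measure (M n) H - measure (M n) (inv y <# H) = (\<Sum>\<^sub>\<infinity>z\<in>H. ?p z - ?p (inv y \<otimes> z))"
      using infsum_diff[OF summable_on_pmf sH, of "M n"] by (simp add: measure_pmf_infsum)
    also have "\<dots> \<le> (\<Sum>\<^sub>\<infinity>z\<in>H. \<bar>?p (inv y \<otimes> z) - ?p z\<bar>)"
      by (rule infsum_mono[OF summable_on_diff[OF summable_on_pmf sH]
            summable_on_subset_banach[OF sabs Hc]]) auto
    also have "\<dots> \<le> translate_dist G y (M n)"
      unfolding translate_dist_def
      by (rule infsum_mono2[OF summable_on_subset_banach[OF sabs Hc] sabs Hc]) auto
    finally show ?thesis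
      by linarith
  qed
  have "(\<lambda>n. translate_dist G y (M n)) \<longlonglongrightarrow> 0"
    using assms(2) y unfolding almost_invariant_def by blast
  then have "\<forall>\<^sub>F n in sequentially. translate_dist G y (M n) < \<epsilon>"
    using \<epsilon> by (rule order_tendstoD)
  then show "\<forall>\<^sub>F n in sequentially. \<forall>H. subgroup H G \<longrightarrow> measure (M n) H - \<epsilon> \<le> measure (M n) (inv y <# H)"
    by (rule eventually_mono) (use bound in \<open>meson diff_left_mono less_imp_le order_trans\<close>)
qed

section \<open>Symmetric random walks on coset spaces\<close>

lemma set_pmf_conv_power:
  assumes "set_pmf \<mu> \<subseteq> carrier G"
  shows "set_pmf (conv_power G \<mu> n) \<subseteq> carrier G"
proof (induction n)
  case (Suc n)
  show ?case
  proof
    fix z assume "z \<in> set_pmf (conv_power G \<mu> (Suc n))"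
    then obtain x y where "x \<in> set_pmf (conv_power G \<mu> n)" "y \<in> set_pmf \<mu>" "z = x \<otimes> y"
      by auto
    then show "z \<in> carrier G"
      using Suc assms by auto
  qed
qed simp

lemma symmetric_pmf_inv:
  assumes "set_pmf \<mu> \<subseteq> carrier G" "symmetric_pmf G \<mu>" "s \<in> set_pmf \<mu>"
  shows "pmf \<mu> (inv s) = pmf \<mu> s" "inv s \<in> set_pmf \<mu>" "s \<in> carrier G"
proof -
  show s: "s \<in> carrier G"
    using assms(1,3) by blast
  then show eq: "pmf \<mu> (inv s) = pmf \<mu> s"
    using assms(2) unfolding symmetric_pmf_def by (metis (no_types))
  show "inv s \<in> set_pmf \<mu>"
    using assms(3) eq by (simp add: set_pmf_iff)
qed

text \<open>The walk ends in \<open>K\<close> with last step \<open>s\<close> exactly if it was in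
  \<open>K #> inv s\<close> before; symmetry of the measure then replaces \<open>inv s\<close> by
  \<open>s\<close>. This is the recursion required by \<open>energy_decay\<close>.\<close>

lemma conv_power_rcoset_Suc:
  assumes \<mu>: "set_pmf \<mu> \<subseteq> carrier G" "finite (set_pmf \<mu>)" "symmetric_pmf G \<mu>"
    and K: "K \<subseteq> carrier G"
  shows "measure (conv_power G \<mu> (Suc n)) K
    = (\<Sum>s\<in>set_pmf \<mu>. pmf \<mu> s * measure (conv_power G \<mu> n) (K #> s))"
proof -
  let ?S = "set_pmf \<mu>" and ?c = "conv_power G \<mu> n"
  note inv_S = symmetric_pmf_inv[OF \<mu>(1,3)]
  \<comment> \<open>Drawing the last step first turns the measure of \<open>K\<close> into a finite
    average over the support of \<mu>.\<close>
  have "conv_power G \<mu> (Suc n) = bind_pmf \<mu> (\<lambda>s. map_pmf (\<lambda>x. x \<otimes> s) ?c)"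
    unfolding conv_power.simps pair_pmf_def map_bind_pmf map_return_pmf
    by (subst bind_commute_pmf) (simp add: map_pmf_def)
  then have "measure (conv_power G \<mu> (Suc n)) K = (\<integral>s. measure (map_pmf (\<lambda>x. x \<otimes> s) ?c) K \<partial>\<mu>)"
    by (simp add: measure_bind_pmf)
  also have "\<dots> = (\<Sum>s\<in>?S. pmf \<mu> s * measure (map_pmf (\<lambda>x. x \<otimes> s) ?c) K)"
    by (subst integral_measure_pmf[OF \<mu>(2)]) auto
  also have "\<dots> = (\<Sum>s\<in>?S. pmf \<mu> (inv s) * measure ?c (K #> inv s))"
  proof (rule sum.cong[OF refl])
    fix s assume s: "s \<in> ?S"
    have "(\<lambda>x. x \<otimes> s) -` K \<inter> carrier G = (K #> inv s) \<inter> carrier G"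
    proof (intro equalityI subsetI)
      fix x assume x: "x \<in> (\<lambda>x. x \<otimes> s) -` K \<inter> carrier G"
      then have "x = (x \<otimes> s) \<otimes> inv s"
        using inv_S(3)[OF s] by (simp add: m_assoc)
      then show "x \<in> (K #> inv s) \<inter> carrier G"
        using x unfolding r_coset_def by blast
    next
      fix x assume x: "x \<in> (K #> inv s) \<inter> carrier G"
      then obtain k where k: "k \<in> K" "x = k \<otimes> inv s"
        unfolding r_coset_def by blast
      then have "x \<otimes> s = k"
        using inv_S(3)[OF s] K by (simp add: m_assoc subset_iff)
      then show "x \<in> (\<lambda>x. x \<otimes> s) -` K \<inter> carrier G"
        using k x by simp
    qed
    then have "measure (map_pmf (\<lambda>x. x \<otimes> s) ?c) K = measure ?c (K #> inv s)"
      using measure_pmf_Int_supset[OF set_pmf_conv_power[OF \<mu>(1)]] by (metis measure_map_pmf)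
    then show "pmf \<mu> s * measure (map_pmf (\<lambda>x. x \<otimes> s) ?c) K = pmf \<mu> (inv s) * measure ?c (K #> inv s)"
      using inv_S(1)[OF s] by simp
  qed
  also have "\<dots> = (\<Sum>s\<in>?S. pmf \<mu> s * measure ?c (K #> s))"
    by (rule sum.reindex_bij_witness[where i = "m_inv G" and j = "m_inv G"]) (use inv_S in auto)
  finally show ?thesis .
qed

text \<open>This is \<open>energy_decay\<close> on the Schreier graph of \<open>H\<close>: the
  vertices are the right cosets, \<open>s\<close> acts by right multiplication, the involution on
  the generators is inversion, and the walk starts at the vertex \<open>H\<close>. The bound 1 is
  the same for all \<open>H\<close> and \<open>x\<close>, which makes later thresholds
  uniform.\<close>

lemma conv_power_smoothing:
  assumes \<mu>: "set_pmf \<mu> \<subseteq> carrier G" "finite (set_pmf \<mu>)" "symmetric_pmf G \<mu>"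
    and H: "subgroup H G" and s: "s \<in> set_pmf \<mu>" and x: "x \<in> carrier G"
  shows "real (Suc n) * (pmf \<mu> s * (measure (conv_power G \<mu> n) (H #> (x \<otimes> s))
    - measure (conv_power G \<mu> (Suc n)) (H #> x))\<^sup>2) \<le> 1"
proof -
  let ?S = "set_pmf \<mu>"
  have Hc: "H \<subseteq> carrier G"
    using H by (simp add: subgroup_def)
  note inv_S = symmetric_pmf_inv[OF \<mu>(1,3)]
  have cosetD: "\<exists>x\<in>carrier G. K = H #> x" if "K \<in> rcosets H" for K
    using that by (auto simp: rcosets_eq_image)
  have closed: "K #> s \<in> rcosets H" "K #> s #> inv s = K" "K #> inv s #> s = K"
    if sK: "s \<in> carrier G" "K \<in> rcosets H" for s K
  proof -
    obtain x where x: "x \<in> carrier G" "K = H #> x"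
      using cosetD[OF sK(2)] by blast
    then show "K #> s \<in> rcosets H" "K #> s #> inv s = K" "K #> inv s #> s = K"
      using sK(1) Hc by (simp_all add: coset_mult_assoc m_assoc rcosets_eq_image)
  qed
  have "real (Suc n) * (pmf \<mu> s * (measure (conv_power G \<mu> n) ((H #> x) #> s)
    - measure (conv_power G \<mu> (Suc n)) (H #> x))\<^sup>2) \<le> 1"
  proof (rule energy_decay[where V = "rcosets H" and T = "\<lambda>s K. K #> s" and S = ?S
        and i = "m_inv G" and ?v0.0 = H and f = "\<lambda>n K. measure (conv_power G \<mu> n) K" and w = "pmf \<mu>"])
    show "sum (pmf \<mu>) ?S = 1"
      using \<mu>(2) by (simp add: sum_pmf_eq_1)
    show "bij_betw (\<lambda>K. K #> s) (rcosets H) (rcosets H)" if "s \<in> ?S" for s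
      by (rule bij_betwI[where g = "\<lambda>K. K #> inv s"]) (use closed inv_S(3)[OF that] in auto)
    show "H \<in> rcosets H"
      using subgroup.subgroup_in_rcosets[OF H is_group] .
    show "measure (conv_power G \<mu> 0) K = (if K = H then 1 else 0)" if "K \<in> rcosets H" for K
    proof -
      obtain x where "x \<in> carrier G" "K = H #> x"
        using cosetD[OF \<open>K \<in> rcosets H\<close>] by blast
      then have "\<one> \<in> K \<longleftrightarrow> K = H"
        using H Hc by (metis coset_mult_one one_closed rcos_self repr_independence subgroup.one_closed)
      then show ?thesis
        by (simp add: indicator_def)
    qed
    show "measure (conv_power G \<mu> (Suc n)) K
      = (\<Sum>s\<in>?S. pmf \<mu> s * measure (conv_power G \<mu> n) (K #> s))" if "K \<in> rcosets H" for n K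
      using subgroup.rcosets_carrier[OF H is_group that] by (intro conv_power_rcoset_Suc \<mu>)
  qed (use \<mu>(2) s x inv_S closed Hc in \<open>auto intro: rcosetsI\<close>)
  then show ?thesis
    using coset_mult_assoc[OF Hc x] inv_S(3)[OF s] by simp
qed

text \<open>Smoothing shows that for large \<open>n\<close> the walk gives nearly equal measure to
  neighbouring cosets, uniformly in \<open>H\<close>. Since the support generates the group, this
  extends to the cosets \<open>H #> x\<close> and \<open>H #> (x \<otimes> y)\<close> for every
  fixed \<open>y\<close>.\<close>

lemma random_walk_detects_index:
  assumes "rank_at_most G r" "prob_on G \<mu>" "symmetric_pmf G \<mu>" "finite (set_pmf \<mu>)"
    "generating_pmf G \<mu>" "pmf \<mu> \<one> > 0"
  shows "detects_index (conv_power G \<mu>)"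
proof -
  let ?S = "set_pmf \<mu>" and ?f = "\<lambda>n K. measure (conv_power G \<mu> n) K"
  have \<mu>: "?S \<subseteq> carrier G"
    using assms(2) by (simp add: prob_on_def)
  \<comment> \<open>Uniformity in \<open>x\<close> as well as in \<open>H\<close> is what makes
    \<open>Q\<close> pass to products and inverses: the estimate is applied again at
    \<open>x \<otimes> y\<close>, respectively at \<open>x \<otimes> inv y\<close>.\<close>
  define Q where "Q y \<longleftrightarrow> (\<forall>\<epsilon>>0. \<forall>\<^sub>F n in sequentially. \<forall>H. subgroup H G \<longrightarrow>
    (\<forall>x\<in>carrier G. \<bar>?f n (H #> x) - ?f n (H #> (x \<otimes> y))\<bar> < \<epsilon>))" for y
  have step: "\<forall>\<^sub>F n in sequentially. \<forall>H. subgroup H G \<longrightarrow>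
    (\<forall>x\<in>carrier G. \<bar>?f n (H #> (x \<otimes> s)) - ?f (Suc n) (H #> x)\<bar> < \<epsilon>)"
    if s: "s \<in> ?S" and \<epsilon>: "\<epsilon> > 0" for s \<epsilon>
  proof -
    have p: "pmf \<mu> s > 0"
      using s by (simp add: pmf_positive)
    \<comment> \<open>From \<open>N\<close> on, a difference of at least \<open>\<epsilon>\<close>
      would make the left side in \<open>conv_power_smoothing\<close> exceed 1.\<close>
    obtain N :: nat where N: "real N > 1 / (pmf \<mu> s * \<epsilon>\<^sup>2)"
      using reals_Archimedean2 by blast
    show ?thesis
    proof (rule eventually_sequentiallyI[of N], intro allI impI ballI, rule ccontr)
      fix n H x
      assume n: "N \<le> n" and H: "subgroup H G" and x: "x \<in> carrier G"
      define e where "e = ?f n (H #> (x \<otimes> s)) - ?f (Suc n) (H #> x)"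
      assume "\<not> \<bar>?f n (H #> (x \<otimes> s)) - ?f (Suc n) (H #> x)\<bar> < \<epsilon>"
      then have "\<epsilon> \<le> \<bar>e\<bar>"
        unfolding e_def by linarith
      then have "\<epsilon>\<^sup>2 \<le> e\<^sup>2"
        using power_mono[of \<epsilon> "\<bar>e\<bar>" 2] \<epsilon> by simp
      then have e: "real (Suc n) * (pmf \<mu> s * \<epsilon>\<^sup>2) \<le> real (Suc n) * (pmf \<mu> s * e\<^sup>2)"
        using p by (intro mult_left_mono) auto
      have "1 < real N * (pmf \<mu> s * \<epsilon>\<^sup>2)"
        using N p \<epsilon> by (simp add: field_simps)
      also have "\<dots> \<le> real (Suc n) * (pmf \<mu> s * \<epsilon>\<^sup>2)"
        using n p \<epsilon> by (intro mult_right_mono) auto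
      also note e
      also have "real (Suc n) * (pmf \<mu> s * e\<^sup>2) \<le> 1"
        unfolding e_def by (rule conv_power_smoothing[OF \<mu> assms(4,3) H s x])
      finally show False
        by simp
    qed
  qed
  have Q_S: "Q s" if s: "s \<in> ?S" for s
    unfolding Q_def
  proof (intro allI impI)
    fix \<epsilon> :: real assume "\<epsilon> > 0"
    then have \<epsilon>: "\<epsilon> / 2 > 0"
      by simp
    \<comment> \<open>The walk may stand still, so the step \<open>\<one>\<close> compares times
      \<open>n\<close> and \<open>Suc n\<close> at the same coset. Combined with the step
      \<open>s\<close>, this compares two cosets at the same time \<open>n\<close>.\<close>
    have one: "\<one> \<in> ?S"
      using assms(6) by (simp add: set_pmf_iff)
    show "\<forall>\<^sub>F n in sequentially. \<forall>H. subgroup H G \<longrightarrow>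
      (\<forall>x\<in>carrier G. \<bar>?f n (H #> x) - ?f n (H #> (x \<otimes> s))\<bar> < \<epsilon>)"
      using step[OF s \<epsilon>] step[OF one \<epsilon>]
    proof eventually_elim
      case (elim n)
      show ?case
      proof (intro allI impI ballI)
        fix H x
        assume H: "subgroup H G" and x: "x \<in> carrier G"
        have "\<bar>?f n (H #> (x \<otimes> s)) - ?f (Suc n) (H #> x)\<bar> < \<epsilon> / 2"
          "\<bar>?f n (H #> x) - ?f (Suc n) (H #> x)\<bar> < \<epsilon> / 2"
          using elim H x by (blast, metis r_one)
        then show "\<bar>?f n (H #> x) - ?f n (H #> (x \<otimes> s))\<bar> < \<epsilon>"
          by linarith
      qed
    qed
  qed
  have Q_inv: "Q (inv y)" if "y \<in> carrier G" "Q y" for y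
    unfolding Q_def
  proof (intro allI impI)
    fix \<epsilon> :: real assume "\<epsilon> > 0"
    then have "\<forall>\<^sub>F n in sequentially. \<forall>H. subgroup H G \<longrightarrow>
      (\<forall>x\<in>carrier G. \<bar>?f n (H #> x) - ?f n (H #> (x \<otimes> y))\<bar> < \<epsilon>)"
      using that(2) unfolding Q_def by blast
    then show "\<forall>\<^sub>F n in sequentially. \<forall>H. subgroup H G \<longrightarrow>
      (\<forall>x\<in>carrier G. \<bar>?f n (H #> x) - ?f n (H #> (x \<otimes> inv y))\<bar> < \<epsilon>)"
    proof eventually_elim
      case (elim n)
      show ?case
      proof (intro allI impI ballI)
        fix H x
        assume H: "subgroup H G" and x: "x \<in> carrier G"
        have "x \<otimes> inv y \<in> carrier G" "x \<otimes> inv y \<otimes> y = x"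
          using x that(1) by (simp_all add: m_assoc)
        then have "\<bar>?f n (H #> (x \<otimes> inv y)) - ?f n (H #> x)\<bar> < \<epsilon>"
          using elim(1) H by metis
        then show "\<bar>?f n (H #> x) - ?f n (H #> (x \<otimes> inv y))\<bar> < \<epsilon>"
          by (simp add: abs_minus_commute)
      qed
    qed
  qed
  have Q_mult: "Q (y \<otimes> z)" if "y \<in> carrier G" "z \<in> carrier G" "Q y" "Q z" for y z
    unfolding Q_def
  proof (intro allI impI)
    fix \<epsilon> :: real assume "\<epsilon> > 0"
    then have "\<epsilon> / 2 > 0"
      by simp
    then have "\<forall>\<^sub>F n in sequentially. \<forall>H. subgroup H G \<longrightarrow>
      (\<forall>x\<in>carrier G. \<bar>?f n (H #> x) - ?f n (H #> (x \<otimes> y))\<bar> < \<epsilon> / 2)"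
      "\<forall>\<^sub>F n in sequentially. \<forall>H. subgroup H G \<longrightarrow>
      (\<forall>x\<in>carrier G. \<bar>?f n (H #> x) - ?f n (H #> (x \<otimes> z))\<bar> < \<epsilon> / 2)"
      using that(3,4) unfolding Q_def by blast+
    then show "\<forall>\<^sub>F n in sequentially. \<forall>H. subgroup H G \<longrightarrow>
      (\<forall>x\<in>carrier G. \<bar>?f n (H #> x) - ?f n (H #> (x \<otimes> (y \<otimes> z)))\<bar> < \<epsilon>)"
    proof eventually_elim
      case (elim n)
      show ?case
      proof (intro allI impI ballI)
        fix H x
        assume H: "subgroup H G" and x: "x \<in> carrier G"
        have "\<bar>?f n (H #> x) - ?f n (H #> (x \<otimes> y))\<bar> < \<epsilon> / 2"
          using elim(1) H x by blast
        moreover have "\<bar>?f n (H #> (x \<otimes> y)) - ?f n (H #> (x \<otimes> y \<otimes> z))\<bar> < \<epsilon> / 2"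
          using elim(2) H x that(1) by simp
        ultimately have "\<bar>?f n (H #> x) - ?f n (H #> (x \<otimes> y \<otimes> z))\<bar> < \<epsilon>"
          by linarith
        then show "\<bar>?f n (H #> x) - ?f n (H #> (x \<otimes> (y \<otimes> z)))\<bar> < \<epsilon>"
          using x that(1,2) by (simp add: m_assoc)
      qed
    qed
  qed
  have Q_one: "Q \<one>"
    unfolding Q_def by (auto intro!: always_eventually)
  have "Q y" if "y \<in> generate G ?S" for y
    using that
  proof (induction rule: generate.induct)
    case one
    show ?case
      by (rule Q_one)
  next
    case (incl s)
    then show ?case
      by (rule Q_S)
  next
    case (inv s)
    then show ?case
      using \<mu> by (intro Q_inv Q_S) auto
  next
    case (eng y z)
    then show ?case
      using assms(5) unfolding generating_pmf_def by (intro Q_mult) auto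
  qed
  then have Q: "Q y" if "y \<in> carrier G" for y
    using that assms(5) unfolding generating_pmf_def by blast
  show ?thesis
  proof (rule detects_indexI[OF assms(1), where A = "\<lambda>H y. H #> y"])
    show "H #> y = H #> z"
      if "subgroup H G" "y \<in> carrier G" "z \<in> carrier G" "(H #> y) \<inter> (H #> z) \<noteq> {}" for H y z
      using that by (metis disjoint_iff repr_independence)
    fix y and \<epsilon> :: real
    assume y: "y \<in> carrier G" and "\<epsilon> > 0"
    then have "\<forall>\<^sub>F n in sequentially. \<forall>H. subgroup H G \<longrightarrow>
      (\<forall>x\<in>carrier G. \<bar>?f n (H #> x) - ?f n (H #> (x \<otimes> y))\<bar> < \<epsilon>)"
      using Q unfolding Q_def by blast
    then show "\<forall>\<^sub>F n in sequentially. \<forall>H. subgroup H G \<longrightarrow> ?f n H - \<epsilon> \<le> ?f n (H #> y)"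
    proof eventually_elim
      case (elim n)
      show ?case
      proof (intro allI impI)
        fix H
        assume H: "subgroup H G"
        have "\<bar>?f n (H #> \<one>) - ?f n (H #> (\<one> \<otimes> y))\<bar> < \<epsilon>"
          using elim(1) H by blast
        moreover have "H #> \<one> = H"
          using H by (simp add: coset_mult_one subgroup.subset)
        ultimately show "?f n H - \<epsilon> \<le> ?f n (H #> y)"
          using y by simp
      qed
    qed
  qed
qed

end

section \<open>Induction on the nilpotency step\<close>

lemma simple_commutator_snoc:
  "xs \<noteq> [] \<Longrightarrow> simple_commutator G (xs @ [x]) = commutator G (simple_commutator G xs) x"
  by (cases xs) simp_all

text \<open>This is the probability that the simple commutator is trivial in the quotient by
  \<open>N\<close>, written without the quotient. For \<open>N = {\<one>}\<close> it is
  \<open>dc\<close>.\<close>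

definition rel_dc :: "('a, 'b) monoid_scheme \<Rightarrow> 'a set \<Rightarrow> nat \<Rightarrow> 'a pmf \<Rightarrow> real" where
  "rel_dc G N k \<mu> = measure_pmf.prob (replicate_pmf (k + 1) \<mu>) {xs. simple_commutator G xs \<in> N}"

text \<open>Each step of the induction spends half of \<alpha>. The number \<open>m\<close> bounds
  the index of centralizers of measure at least \<open>\<alpha> / 2\<close>, and the power of
  \<open>m\<close> is the bound of \<open>index_index_core\<close>.\<close>

primrec index_bound :: "nat \<Rightarrow> nat \<Rightarrow> real \<Rightarrow> nat" where
  "index_bound r 0 \<alpha> = nat \<lceil>2 / \<alpha>\<rceil>"
| "index_bound r (Suc k) \<alpha> = (let m = nat \<lceil>4 / \<alpha>\<rceil> in
     index_bound r k (\<alpha> / 2) * m ^ (m * (m ^ m) ^ (2 * r)))"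

context group
begin

section \<open>Commutators and centralizers modulo a normal subgroup\<close>

lemma commutator_closed [simp]:
  "\<lbrakk>x \<in> carrier G; y \<in> carrier G\<rbrakk> \<Longrightarrow> commutator G x y \<in> carrier G"
  by (simp add: commutator_def)

lemma simple_commutator_closed:
  assumes "set xs \<subseteq> carrier G"
  shows "simple_commutator G xs \<in> carrier G"
  using assms
proof (induction xs rule: rev_induct)
  case (snoc x xs)
  then show ?case
    by (cases "xs = []") (simp_all add: simple_commutator_snoc)
qed simp

text \<open>The commutator equals \<open>inv (y \<otimes> x) \<otimes> (x \<otimes> y)\<close>, and
  left and right cosets of a normal subgroup agree. So membership in \<open>N\<close> means that the
  images in the quotient commute.\<close>

lemma commutator_mem_normal_iff:
  assumes "N \<lhd> G" "x \<in> carrier G" "y \<in> carrier G"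
  shows "commutator G x y \<in> N \<longleftrightarrow> N #> (x \<otimes> y) = N #> (y \<otimes> x)"
proof -
  interpret N: normal N G
    by (rule assms)
  have "commutator G x y = inv (y \<otimes> x) \<otimes> (x \<otimes> y)"
    using assms by (simp add: commutator_def inv_mult_group m_assoc)
  moreover have "inv a \<otimes> b \<in> N \<longleftrightarrow> b \<otimes> inv a \<in> N" if "a \<in> carrier G" "b \<in> carrier G" for a b
  proof
    assume "inv a \<otimes> b \<in> N"
    then have "a \<otimes> (inv a \<otimes> b) \<otimes> inv a \<in> N"
      using N.inv_op_closed2 that by blast
    then show "b \<otimes> inv a \<in> N"
      using that by (simp add: mult_inv_cancel)
  next
    assume "b \<otimes> inv a \<in> N"
    then have "inv a \<otimes> (b \<otimes> inv a) \<otimes> a \<in> N"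
      using N.inv_op_closed1 that by blast
    then show "inv a \<otimes> b \<in> N"
      using that by (simp add: m_assoc)
  qed
  ultimately show ?thesis
    using assms N.subgroup_axioms by (simp add: rcos_eq_iff)
qed

lemma commute_inv:
  assumes "a \<in> carrier G" "b \<in> carrier G" "a \<otimes> b = b \<otimes> a"
  shows "a \<otimes> inv b = inv b \<otimes> a"
proof -
  have "a \<otimes> inv b = inv b \<otimes> (b \<otimes> a) \<otimes> inv b"
    using assms(1,2) by (simp add: m_assoc mult_inv_cancel)
  also have "\<dots> = inv b \<otimes> (a \<otimes> b) \<otimes> inv b"
    using assms(3) by (simp only:)
  also have "\<dots> = inv b \<otimes> a"
    using assms(1,2) by (simp add: m_assoc)
  finally show ?thesis .
qed

text \<open>The set is the preimage under \<open>h\<close> of the centralizer of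
  \<open>a\<close>.\<close>

lemma subgroup_hom_centralizer:
  assumes "group_hom G Q h" "a \<in> carrier Q"
  shows "subgroup {x \<in> carrier G. a \<otimes>\<^bsub>Q\<^esub> h x = h x \<otimes>\<^bsub>Q\<^esub> a} G"
proof -
  interpret h: group_hom G Q h
    by (rule assms)
  let ?C = "{x \<in> carrier G. a \<otimes>\<^bsub>Q\<^esub> h x = h x \<otimes>\<^bsub>Q\<^esub> a}"
  show ?thesis
  proof (rule subgroup.intro)
    show "x \<otimes> y \<in> ?C" if "x \<in> ?C" "y \<in> ?C" for x y
    proof -
      have xy: "x \<in> carrier G" "y \<in> carrier G"
        and comm: "a \<otimes>\<^bsub>Q\<^esub> h x = h x \<otimes>\<^bsub>Q\<^esub> a" "a \<otimes>\<^bsub>Q\<^esub> h y = h y \<otimes>\<^bsub>Q\<^esub> a"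
        using that by auto
      have "a \<otimes>\<^bsub>Q\<^esub> (h x \<otimes>\<^bsub>Q\<^esub> h y) = (a \<otimes>\<^bsub>Q\<^esub> h x) \<otimes>\<^bsub>Q\<^esub> h y"
        using xy assms(2) by (simp add: h.H.m_assoc)
      also have "\<dots> = h x \<otimes>\<^bsub>Q\<^esub> (a \<otimes>\<^bsub>Q\<^esub> h y)"
        using xy assms(2) unfolding comm(1) by (simp add: h.H.m_assoc)
      also have "\<dots> = h x \<otimes>\<^bsub>Q\<^esub> h y \<otimes>\<^bsub>Q\<^esub> a"
        using xy assms(2) unfolding comm(2) by (simp add: h.H.m_assoc)
      finally show ?thesis
        using xy by simp
    qed
    show "inv x \<in> ?C" if "x \<in> ?C" for x
      using that h.H.commute_inv[OF assms(2), of "h x"] by auto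
  qed (use assms(2) in auto)
qed

text \<open>Both sets are the preimage of the centralizer of the coset of \<open>g\<close> in
  \<open>G Mod N\<close>. The first form carries the probabilistic estimate, the second describes
  \<open>core_centralizer\<close> as an intersection.\<close>

lemma subgroup_centralizer_mod:
  assumes "N \<lhd> G" "g \<in> carrier G"
  shows "subgroup {x \<in> carrier G. commutator G g x \<in> N} G"
    and "subgroup {x \<in> carrier G. commutator G x g \<in> N} G"
proof -
  interpret N: normal N G
    by (rule assms)
  obtain Q and h :: "'a \<Rightarrow> 'a set" where Q: "Q = G Mod N" and h: "h = (\<lambda>x. N #> x)"
    by blast
  have hom: "group_hom G Q h"
    using N.factorgroup_is_group N.r_coset_hom_Mod
    unfolding Q h group_hom_def group_hom_axioms_def by (simp add: is_group)
  interpret h: group_hom G Q h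
    by (rule hom)
  let ?C = "{x \<in> carrier G. h g \<otimes>\<^bsub>Q\<^esub> h x = h x \<otimes>\<^bsub>Q\<^esub> h g}"
  have iff: "commutator G x y \<in> N \<longleftrightarrow> h x \<otimes>\<^bsub>Q\<^esub> h y = h y \<otimes>\<^bsub>Q\<^esub> h x"
    if "x \<in> carrier G" "y \<in> carrier G" for x y
    using commutator_mem_normal_iff[OF assms(1) that] h.hom_mult[of x y] h.hom_mult[of y x] that
    unfolding h by metis
  have "{x \<in> carrier G. commutator G g x \<in> N} = ?C" "{x \<in> carrier G. commutator G x g \<in> N} = ?C"
    using iff[OF assms(2)] iff[OF _ assms(2)] by (auto simp del: h.hom_mult)
  then show "subgroup {x \<in> carrier G. commutator G g x \<in> N} G"
    "subgroup {x \<in> carrier G. commutator G x g \<in> N} G"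
    using subgroup_hom_centralizer[OF hom h.hom_closed[OF assms(2)]] by simp_all
qed

text \<open>For \<open>m > 0\<close> this is the preimage of the centralizer, in the quotient by
  \<open>N\<close>, of the image of \<open>index_core m\<close>. It takes the place of
  \<open>N\<close> at the next stage of the induction.\<close>

definition core_centralizer :: "'a set \<Rightarrow> nat \<Rightarrow> 'a set" where
  "core_centralizer N m = {g \<in> carrier G. \<forall>x\<in>index_core m. commutator G g x \<in> N}"

lemma commutator_conj:
  assumes "x \<in> carrier G" "g \<in> carrier G" "y \<in> carrier G"
  shows "commutator G (x \<otimes> g \<otimes> inv x) y = x \<otimes> commutator G g (inv x \<otimes> y \<otimes> x) \<otimes> inv x"
  using assms by (simp add: commutator_def inv_mult_group m_assoc mult_inv_cancel)

text \<open>Centralizers of normal subgroups are normal: \<open>commutator_conj\<close> moves a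
  conjugation from \<open>g\<close> to \<open>y\<close>, and \<open>index_core m\<close> is
  invariant under conjugation.\<close>

lemma core_centralizer_normal:
  assumes "N \<lhd> G" "m > 0"
  shows "core_centralizer N m \<lhd> G"
proof -
  interpret N: normal N G
    by (rule assms)
  have core: "index_core m \<subseteq> carrier G" "\<one> \<in> index_core m"
    using subgroup_index_core[OF assms(2)] by (auto simp: subgroup_def)
  have eq: "core_centralizer N m = (\<Inter>x\<in>index_core m. {g \<in> carrier G. commutator G g x \<in> N})"
    using core(2) by (auto simp: core_centralizer_def)
  have "subgroup (core_centralizer N m) G"
    unfolding eq
  proof (rule subgroups_Inter)
    fix H assume "H \<in> (\<lambda>x. {g \<in> carrier G. commutator G g x \<in> N}) ` index_core m"
    then obtain x where "x \<in> index_core m" "H = {g \<in> carrier G. commutator G g x \<in> N}"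
      by blast
    then show "subgroup H G"
      using subgroup_centralizer_mod(2)[OF assms(1), of x] core(1) by blast
  qed (use core(2) in auto)
  moreover have "x \<otimes> g \<otimes> inv x \<in> core_centralizer N m"
    if g: "g \<in> core_centralizer N m" and x: "x \<in> carrier G" for x g
    unfolding core_centralizer_def
  proof (intro CollectI conjI ballI)
    have gG: "g \<in> carrier G"
      using g by (simp add: core_centralizer_def)
    then show "x \<otimes> g \<otimes> inv x \<in> carrier G"
      using x by simp
    fix y assume y: "y \<in> index_core m"
    then have yG: "y \<in> carrier G"
      using core(1) by blast
    have "inv x \<otimes> y \<otimes> x \<in> index_core m"
      using index_core_conj[OF assms(2) y, of "inv x"] x by simp
    then have "commutator G g (inv x \<otimes> y \<otimes> x) \<in> N"
      using g by (simp add: core_centralizer_def)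
    then show "commutator G (x \<otimes> g \<otimes> inv x) y \<in> N"
      unfolding commutator_conj[OF x gG yG] using N.inv_op_closed2 x by blast
  qed
  ultimately show ?thesis
    by (simp add: normal_inv_iff)
qed

text \<open>If the commutator of the first \<open>k + 1\<close> entries lies outside
  \<open>core_centralizer N m\<close>, its centralizer modulo \<open>N\<close> does not contain
  \<open>index_core m\<close>. This centralizer then has index greater than \<open>m\<close>, hence
  measure less than \<beta>, so the last entry succeeds with probability less than \<beta>.\<close>

lemma rel_dc_Suc_le:
  assumes N: "N \<lhd> G" and \<mu>: "set_pmf \<mu> \<subseteq> carrier G"
    and idx: "\<And>H. \<lbrakk>subgroup H G; \<beta> \<le> measure \<mu> H\<rbrakk> \<Longrightarrow> index_at_most G H m"
    and "\<beta> \<ge> 0"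
  shows "rel_dc G N (Suc k) \<mu> \<le> rel_dc G (core_centralizer N m) k \<mu> + \<beta>"
proof -
  let ?R = "replicate_pmf (k + 1) \<mu>" and ?Z = "core_centralizer N m"
  let ?g = "\<lambda>xs. measure \<mu> {x. simple_commutator G (xs @ [x]) \<in> N}"
  \<comment> \<open>The last entry is drawn separately, so that \<open>?g xs\<close> is the
    conditional probability given the first \<open>k + 1\<close> entries \<open>xs\<close>.\<close>
  have "replicate_pmf (Suc k + 1) \<mu> = bind_pmf ?R (\<lambda>xs. map_pmf (\<lambda>x. xs @ [x]) \<mu>)"
    using replicate_pmf_distrib[of "k + 1" 1 \<mu>]
    by (simp add: replicate_pmf_1[unfolded One_nat_def] map_pmf_def bind_assoc_pmf bind_return_pmf
        del: replicate_pmf.simps)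
  then have "rel_dc G N (Suc k) \<mu> = (\<integral>xs. ?g xs \<partial>?R)"
    unfolding rel_dc_def by (simp add: measure_bind_pmf vimage_def del: replicate_pmf.simps)
  also have "\<dots> \<le> (\<integral>xs. indicator {xs. simple_commutator G xs \<in> ?Z} xs + \<beta> \<partial>?R)"
  proof (rule integral_mono_AE)
    show "integrable ?R ?g"
      by (rule measure_pmf.integrable_const_bound[where B = 1]) auto
    show "integrable ?R (\<lambda>xs. indicator {xs. simple_commutator G xs \<in> ?Z} xs + \<beta>)"
      by (rule measure_pmf.integrable_const_bound[where B = "1 + \<beta>"])
        (use \<open>\<beta> \<ge> 0\<close> in \<open>auto simp: indicator_def\<close>)
    show "AE xs in ?R. ?g xs \<le> indicator {xs. simple_commutator G xs \<in> ?Z} xs + \<beta>"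
    proof (rule AE_pmfI)
      fix xs assume "xs \<in> set_pmf ?R"
      then have xs: "set xs \<subseteq> carrier G" "xs \<noteq> []"
        using \<mu> by (auto simp: set_replicate_pmf simp del: replicate_pmf.simps)
      let ?c = "simple_commutator G xs"
      have c: "?c \<in> carrier G"
        using simple_commutator_closed[OF xs(1)] .
      show "?g xs \<le> indicator {xs. simple_commutator G xs \<in> ?Z} xs + \<beta>"
      proof (cases "?c \<in> ?Z")
        case True
        then show ?thesis
          using \<open>\<beta> \<ge> 0\<close> by (simp add: add_increasing2)
      next
        case False
        let ?C = "{x \<in> carrier G. commutator G ?c x \<in> N}"
        have "?g xs = measure \<mu> ({x. commutator G ?c x \<in> N} \<inter> carrier G)"
          using xs(2) by (simp add: simple_commutator_snoc measure_pmf_Int_supset[OF \<mu>])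
        also have "{x. commutator G ?c x \<in> N} \<inter> carrier G = ?C"
          by auto
        finally have eq: "?g xs = measure \<mu> ?C" .
        have "measure \<mu> ?C < \<beta>"
        proof (rule ccontr)
          assume "\<not> measure \<mu> ?C < \<beta>"
          then have "index_at_most G ?C m"
            using idx subgroup_centralizer_mod(1)[OF N c] by simp
          then have "index_core m \<subseteq> ?C"
            unfolding index_core_def using subgroup_centralizer_mod(1)[OF N c] by blast
          then show False
            using False c by (auto simp: core_centralizer_def)
        qed
        then show ?thesis
          using eq False by simp
      qed
    qed
  qed
  also have "\<dots> = rel_dc G ?Z k \<mu> + \<beta>"
    unfolding rel_dc_def
    by (subst Bochner_Integration.integral_add)
      (auto simp del: replicate_pmf.simps intro!: measure_pmf.integrable_const_bound[where B = 1])
  finally show ?thesis .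
qed

text \<open>A lower bound for infinitely many \<open>n\<close> can be combined with the eventual
  property in \<open>detects_index\<close>. Both \<open>N\<close> and \<alpha> vary in the
  induction, as a step passes to \<open>core_centralizer N m\<close> and to
  \<open>\<alpha> / 2\<close>. For \<open>k = 0\<close> the subgroup is \<open>N\<close>
  itself.\<close>

lemma index_of_positive_rel_dc:
  assumes r: "rank_at_most G r" and M: "detects_index M" "\<And>n. prob_on G (M n)"
    and "N \<lhd> G" "\<alpha> > 0" "\<exists>\<^sub>F n in sequentially. \<alpha> \<le> rel_dc G N k (M n)"
  shows "\<exists>H. subgroup H G \<and> index_at_most G H (index_bound r k \<alpha>) \<and>
    (\<forall>xs. set xs \<subseteq> H \<and> length xs = k + 1 \<longrightarrow> simple_commutator G xs \<in> N)"
  using assms(4-6)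
proof (induction k arbitrary: N \<alpha>)
  case 0
  interpret N: normal N G
    by (rule 0)
  have dc: "rel_dc G N 0 (M n) = measure (M n) N" for n
    by (simp add: rel_dc_def replicate_pmf_1[unfolded One_nat_def] vimage_def del: replicate_pmf.simps)
  have "\<forall>\<^sub>F n in sequentially. \<forall>H. subgroup H G \<and> \<alpha> \<le> measure (M n) H \<longrightarrow>
     index_at_most G H (nat \<lceil>2 / \<alpha>\<rceil>)"
    using M(1) \<open>\<alpha> > 0\<close> unfolding detects_index_def by blast
  then obtain n where "\<forall>H. subgroup H G \<and> \<alpha> \<le> measure (M n) H \<longrightarrow> index_at_most G H (nat \<lceil>2 / \<alpha>\<rceil>)"
    "\<alpha> \<le> measure (M n) N"
    using 0(3) unfolding dc by (metis (mono_tags, lifting) frequently_eventually_frequently frequently_ex)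
  then have "index_at_most G N (index_bound r 0 \<alpha>)"
    using N.subgroup_axioms by simp
  moreover have "simple_commutator G xs \<in> N" if "set xs \<subseteq> N" "length xs = 0 + 1" for xs
    using that by (cases xs) auto
  ultimately show ?case
    using N.subgroup_axioms by blast
next
  case (Suc k)
  define m where "m = nat \<lceil>4 / \<alpha>\<rceil>"
  have m: "m > 0"
    using \<open>\<alpha> > 0\<close> by (simp add: m_def)
  \<comment> \<open>This matches \<open>m\<close> with the index bound that
    \<open>detects_index\<close> gives at level \<open>\<alpha> / 2\<close>.\<close>
  have m': "nat \<lceil>2 / (\<alpha> / 2)\<rceil> = m"
    by (simp add: m_def)
  let ?Z = "core_centralizer N m"
  have ev: "\<forall>\<^sub>F n in sequentially. \<forall>H. subgroup H G \<and> \<alpha> / 2 \<le> measure (M n) H \<longrightarrow> index_at_most G H m"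
    using M(1)[unfolded detects_index_def, rule_format, of "\<alpha> / 2"] \<open>\<alpha> > 0\<close> unfolding m' by simp
  have "\<exists>\<^sub>F n in sequentially. \<alpha> / 2 \<le> rel_dc G ?Z k (M n)"
    using frequently_eventually_frequently[OF Suc.prems(3) ev]
  proof (rule frequently_elim1)
    fix n
    assume a: "\<alpha> \<le> rel_dc G N (Suc k) (M n) \<and>
      (\<forall>H. subgroup H G \<and> \<alpha> / 2 \<le> measure (M n) H \<longrightarrow> index_at_most G H m)"
    have "rel_dc G N (Suc k) (M n) \<le> rel_dc G ?Z k (M n) + \<alpha> / 2"
      by (rule rel_dc_Suc_le[OF Suc.prems(1)]) (use a M(2) \<open>\<alpha> > 0\<close> in \<open>auto simp: prob_on_def\<close>)
    then show "\<alpha> / 2 \<le> rel_dc G ?Z k (M n)"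
      using a by linarith
  qed
  then obtain K where K: "subgroup K G" "index_at_most G K (index_bound r k (\<alpha> / 2))"
    "\<And>xs. \<lbrakk>set xs \<subseteq> K; length xs = k + 1\<rbrakk> \<Longrightarrow> simple_commutator G xs \<in> ?Z"
    using Suc.IH[OF core_centralizer_normal[OF Suc.prems(1) m], of "\<alpha> / 2"] \<open>\<alpha> > 0\<close> by auto
  let ?H = "K \<inter> index_core m"
  \<comment> \<open>All entries but the last are used as elements of \<open>K\<close>, which puts
    their commutator in \<open>?Z\<close>; the last entry is used as an element of
    \<open>index_core m\<close>, with which \<open>?Z\<close> commutes modulo
    \<open>N\<close>.\<close>
  have "simple_commutator G xs \<in> N" if xs: "set xs \<subseteq> ?H" "length xs = Suc k + 1" for xs
  proof -
    obtain ys x where ys: "xs = ys @ [x]"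
      using xs(2) by (cases xs rule: rev_cases) auto
    have "simple_commutator G ys \<in> ?Z"
      by (rule K(3)) (use xs ys in auto)
    moreover have "x \<in> index_core m" "ys \<noteq> []"
      using xs ys by auto
    ultimately show ?thesis
      unfolding ys by (simp add: simple_commutator_snoc core_centralizer_def)
  qed
  moreover have "index_at_most G ?H (index_bound r (Suc k) \<alpha>)"
    using index_at_most_Int[OF K(1,2) subgroup_index_core[OF m] index_index_core[OF r m]]
    by (simp add: Let_def m_def)
  moreover have "subgroup ?H G"
    using K(1) subgroup_index_core[OF m] by (rule subgroups_Inter_pair)
  ultimately show ?case
    by blast
qed

section \<open>From the limit superior to a nilpotent subgroup\<close>

lemma simple_commutator_subgroup:
  assumes "subgroup H G" "set xs \<subseteq> H"
  shows "simple_commutator (G\<lparr>carrier := H\<rparr>) xs = simple_commutator G xs \<and> simple_commutator G xs \<in> H"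
  using assms(2)
proof (induction xs rule: rev_induct)
  case Nil
  then show ?case
    using assms(1) by (simp add: subgroup.one_closed)
next
  case (snoc x xs)
  interpret H: subgroup H G
    by (rule assms)
  have comm: "commutator (G\<lparr>carrier := H\<rparr>) a b = commutator G a b" "commutator G a b \<in> H"
    if "a \<in> H" "b \<in> H" for a b
    using that assms(1) by (simp_all add: commutator_def m_inv_consistent)
  show ?case
    using snoc comm by (cases "xs = []") (simp_all add: simple_commutator_snoc)
qed

lemma random_walk_case_detects_index:
  assumes "rank_at_most G r" "random_walk_case G M"
  shows "detects_index M" "prob_on G (M n)"
proof -
  obtain \<mu> where \<mu>: "prob_on G \<mu>" "symmetric_pmf G \<mu>" "finite (set_pmf \<mu>)" "generating_pmf G \<mu>"
    "pmf \<mu> \<one> > 0" and M: "M = (\<lambda>n. conv_power G \<mu> (Suc n))"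
    using assms(2) unfolding random_walk_case_def by blast
  show "prob_on G (M n)"
    using set_pmf_conv_power[of \<mu> "Suc n"] \<mu>(1) unfolding M prob_on_def by blast
  \<comment> \<open>\<open>M n\<close> is the walk after \<open>Suc n\<close> steps, and an eventual
    property is insensitive to this shift.\<close>
  show "detects_index M"
    using random_walk_detects_index[OF assms(1) \<mu>] unfolding M detects_index_def
    by (intro allI impI, subst eventually_sequentially_Suc) simp
qed

text \<open>The induction is started with \<open>N = {\<one>}\<close>. A limit superior of at least
  \<alpha> guarantees values above any smaller number infinitely often; the choice
  \<open>\<alpha> / 2\<close> explains the argument of the constant.\<close>

lemma index_bound_correct:
  assumes "\<alpha> > 0"
  shows "nilpotent_index_bound r k \<alpha> (index_bound r k (\<alpha> / 2)) G"
  unfolding nilpotent_index_bound_def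
proof (intro impI allI)
  fix M assume G: "group G \<and> rank_at_most G r"
    and M: "(random_walk_case G M \<or> amenable_case G M) \<and> ereal \<alpha> \<le> dc_limsup G k M"
  have det: "detects_index M" and prob: "\<And>n. prob_on G (M n)"
    using M G random_walk_case_detects_index almost_invariant_detects_index
    unfolding amenable_case_def by blast+
  have dc: "dc G k \<mu> = rel_dc G {\<one>} k \<mu>" for \<mu>
    by (simp add: dc_def rel_dc_def del: replicate_pmf.simps)
  have "\<exists>\<^sub>F n in sequentially. \<alpha> / 2 \<le> rel_dc G {\<one>} k (M n)"
  proof (rule ccontr)
    assume "\<not> ?thesis"
    then have "\<forall>\<^sub>F n in sequentially. ereal (dc G k (M n)) \<le> ereal (\<alpha> / 2)"
      unfolding not_frequently dc by (rule eventually_mono) simp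
    then have "dc_limsup G k M \<le> ereal (\<alpha> / 2)"
      unfolding dc_limsup_def by (rule Limsup_bounded)
    with M assms show False
      by (metis ereal_less_eq(3) field_sum_of_halves less_add_same_cancel1 not_le order_trans half_gt_zero)
  qed
  then obtain H where H: "subgroup H G" "index_at_most G H (index_bound r k (\<alpha> / 2))"
    "\<And>xs. \<lbrakk>set xs \<subseteq> H; length xs = k + 1\<rbrakk> \<Longrightarrow> simple_commutator G xs = \<one>"
    using index_of_positive_rel_dc[OF _ det prob one_is_normal, of r "\<alpha> / 2" k] assms G by auto
  moreover have "step_nilpotent k (G\<lparr>carrier := H\<rparr>)"
    unfolding step_nilpotent_def using H simple_commutator_subgroup[OF H(1)] by simp
  ultimately show "\<exists>H. subgroup H G \<and> step_nilpotent k (G\<lparr>carrier := H\<rparr>)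
      \<and> index_at_most G H (index_bound r k (\<alpha> / 2))"
    by blast
qed

end

section \<open>Invariance under isomorphism\<close>

text \<open>Every generated element is the product of a finite word in the generators and their
  inverses, and there are countably many such words.\<close>

lemma (in group) countable_generate:
  assumes "S \<subseteq> carrier G" "countable S"
  shows "countable (generate G S)"
proof -
  let ?T = "S \<union> m_inv G ` S" and ?f = "\<lambda>xs. foldr (\<otimes>) xs \<one>"
  have T: "?T \<subseteq> carrier G"
    using assms(1) by auto
  have closed: "?f xs \<in> carrier G" if "xs \<in> lists ?T" for xs
    using that T by (induction xs) auto
  have append: "?f (xs @ ys) = ?f xs \<otimes> ?f ys" if "xs \<in> lists ?T" "ys \<in> lists ?T" for xs ys
    using that(1)
  proof (induction xs)
    case (Cons x xs)
    then have "x \<in> carrier G" "?f xs \<in> carrier G" "?f ys \<in> carrier G"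
      using T closed that(2) by blast+
    with Cons.IH show ?case
      by (simp add: m_assoc)
  qed (use closed that(2) in simp)
  have "generate G S \<subseteq> ?f ` lists ?T"
  proof
    fix z assume "z \<in> generate G S"
    then show "z \<in> ?f ` lists ?T"
    proof induction
      case one
      show ?case
        by (rule image_eqI[of _ _ "[]"]) auto
    next
      case (incl s)
      show ?case
        by (rule image_eqI[of _ _ "[s]"]) (use incl assms(1) in auto)
    next
      case (inv s)
      show ?case
        by (rule image_eqI[of _ _ "[inv s]"]) (use inv assms(1) in auto)
    next
      case (eng y z)
      then obtain xs ys where "xs \<in> lists ?T" "y = ?f xs" "ys \<in> lists ?T" "z = ?f ys"
        by blast
      then show ?case
        by (intro image_eqI[of _ _ "xs @ ys"]) (simp_all only: append append_in_lists_conv)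
    qed
  qed
  moreover have "countable (?f ` lists ?T)"
    using assms(2) by (intro countable_image countable_lists) auto
  ultimately show ?thesis
    by (rule countable_subset)
qed

lemma replicate_pmf_map: "replicate_pmf n (map_pmf f p) = map_pmf (map f) (replicate_pmf n p)"
  by (induction n) (simp_all add: map_bind_pmf bind_map_pmf)

text \<open>Only points of the support matter, which suits isomorphisms that are injective on a
  carrier but possibly not on the whole type.\<close>

lemma measure_map_pmf_cong:
  assumes "\<And>x. x \<in> set_pmf p \<Longrightarrow> f x \<in> B \<longleftrightarrow> x \<in> A"
  shows "measure (map_pmf f p) B = measure (measure_pmf p) A"
  unfolding measure_map_pmf
  by (rule measure_pmf.finite_measure_eq_AE) (use assms in \<open>auto simp: AE_measure_pmf_iff\<close>)

section \<open>Transport along a group isomorphism\<close>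

locale group_isomorphism = group_hom +
  assumes bij: "bij_betw h (carrier G) (carrier H)"
begin

lemma h_eq_iff: "\<lbrakk>x \<in> carrier G; y \<in> carrier G\<rbrakk> \<Longrightarrow> h x = h y \<longleftrightarrow> x = y"
  using bij by (auto simp: bij_betw_def inj_on_def)

lemma image_carrier: "h ` carrier G = carrier H"
  using bij by (simp add: bij_betw_def)

lemma carrier_cases:
  assumes "y \<in> carrier H"
  obtains x where "x \<in> carrier G" "y = h x"
  using assms image_carrier by blast

lemma rank_at_most_iso: "rank_at_most G r \<Longrightarrow> rank_at_most H r"
proof -
  assume "rank_at_most G r"
  then obtain S where S: "S \<subseteq> carrier G" "finite S" "card S \<le> r" "generate G S = carrier G"
    unfolding rank_at_most_def by blast
  have "h ` S \<subseteq> carrier H" "finite (h ` S)" "card (h ` S) \<le> r" "generate H (h ` S) = carrier H"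
    using S image_carrier generate_img[OF S(1)] card_image_le[OF S(2), of h] by auto
  then show ?thesis
    unfolding rank_at_most_def by blast
qed

lemma prob_on_iso: "prob_on G \<mu> \<Longrightarrow> prob_on H (map_pmf h \<mu>)"
  unfolding prob_on_def using image_carrier by auto

lemma pmf_map_iso:
  assumes "prob_on G \<mu>" "x \<in> carrier G"
  shows "pmf (map_pmf h \<mu>) (h x) = pmf \<mu> x"
proof -
  have "pmf (map_pmf h \<mu>) (h x) = measure (map_pmf h \<mu>) {h x}"
    by (simp add: measure_pmf_single)
  also have "\<dots> = measure \<mu> {x}"
    using assms h_eq_iff by (intro measure_map_pmf_cong) (auto simp: prob_on_def)
  finally show ?thesis
    by (simp add: measure_pmf_single)
qed

lemma conv_power_iso:
  assumes "prob_on G \<mu>"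
  shows "conv_power H (map_pmf h \<mu>) n = map_pmf h (conv_power G \<mu> n)"
proof (induction n)
  case (Suc n)
  have "conv_power H (map_pmf h \<mu>) (Suc n)
    = map_pmf (\<lambda>(x, y). h x \<otimes>\<^bsub>H\<^esub> h y) (pair_pmf (conv_power G \<mu> n) \<mu>)"
    by (simp add: Suc map_pair[symmetric] map_pmf_comp case_prod_unfold)
  also have "\<dots> = map_pmf (\<lambda>(x, y). h (x \<otimes>\<^bsub>G\<^esub> y)) (pair_pmf (conv_power G \<mu> n) \<mu>)"
  proof (rule map_pmf_cong[OF refl])
    fix z assume "z \<in> set_pmf (pair_pmf (conv_power G \<mu> n) \<mu>)"
    then have "fst z \<in> carrier G" "snd z \<in> carrier G"
      using G.set_pmf_conv_power[of \<mu> n] assms by (auto simp: prob_on_def)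
    then show "(case z of (x, y) \<Rightarrow> h x \<otimes>\<^bsub>H\<^esub> h y) = (case z of (x, y) \<Rightarrow> h (x \<otimes>\<^bsub>G\<^esub> y))"
      by (simp add: case_prod_unfold)
  qed
  also have "\<dots> = map_pmf h (conv_power G \<mu> (Suc n))"
    by (simp add: map_pmf_comp case_prod_unfold)
  finally show ?case .
qed simp

lemma random_walk_case_iso:
  assumes "random_walk_case G M"
  shows "random_walk_case H (\<lambda>n. map_pmf h (M n))"
proof -
  obtain \<mu> where \<mu>: "prob_on G \<mu>" "symmetric_pmf G \<mu>" "finite (set_pmf \<mu>)" "generating_pmf G \<mu>"
    "pmf \<mu> \<one>\<^bsub>G\<^esub> > 0" and M: "M = (\<lambda>n. conv_power G \<mu> (Suc n))"
    using assms unfolding random_walk_case_def by blast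
  have "symmetric_pmf H (map_pmf h \<mu>)"
    unfolding symmetric_pmf_def
  proof
    fix y assume "y \<in> carrier H"
    then obtain x where x: "x \<in> carrier G" "y = h x"
      by (rule carrier_cases)
    have "pmf \<mu> x = pmf \<mu> (inv\<^bsub>G\<^esub> x)"
      using \<mu>(2) x(1) unfolding symmetric_pmf_def by blast
    then have "pmf (map_pmf h \<mu>) (h x) = pmf (map_pmf h \<mu>) (h (inv\<^bsub>G\<^esub> x))"
      using x(1) \<mu>(1) by (simp only: pmf_map_iso G.inv_closed)
    then show "pmf (map_pmf h \<mu>) y = pmf (map_pmf h \<mu>) (inv\<^bsub>H\<^esub> y)"
      using x by (simp only: hom_inv)
  qed
  moreover have "generating_pmf H (map_pmf h \<mu>)"
    using \<mu>(1,4) generate_img[of "set_pmf \<mu>"] image_carrier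
    by (simp add: generating_pmf_def prob_on_def)
  moreover have "pmf (map_pmf h \<mu>) \<one>\<^bsub>H\<^esub> > 0"
    using pmf_map_iso[OF \<mu>(1), of "\<one>\<^bsub>G\<^esub>"] \<mu>(5) by simp
  moreover have "(\<lambda>n. map_pmf h (M n)) = (\<lambda>n. conv_power H (map_pmf h \<mu>) (Suc n))"
    unfolding M by (simp only: conv_power_iso[OF \<mu>(1)])
  ultimately show ?thesis
    unfolding random_walk_case_def using prob_on_iso[OF \<mu>(1)] \<mu>(3) by auto
qed

lemma amenable_iso:
  assumes "amenable G"
  shows "amenable H"
proof -
  obtain m :: "'a set \<Rightarrow> real" where m: "(\<forall>A. A \<subseteq> carrier G \<longrightarrow> 0 \<le> m A) \<and> m (carrier G) = 1 \<and>
      (\<forall>A B. A \<subseteq> carrier G \<and> B \<subseteq> carrier G \<and> A \<inter> B = {} \<longrightarrow> m (A \<union> B) = m A + m B) \<and>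
      (\<forall>x\<in>carrier G. \<forall>A. A \<subseteq> carrier G \<longrightarrow> m (x <#\<^bsub>G\<^esub> A) = m A)"
    using assms unfolding amenable_def ..
  then have nonneg: "\<And>A. A \<subseteq> carrier G \<Longrightarrow> 0 \<le> m A" and one: "m (carrier G) = 1"
    and add: "\<And>A B. \<lbrakk>A \<subseteq> carrier G; B \<subseteq> carrier G; A \<inter> B = {}\<rbrakk> \<Longrightarrow> m (A \<union> B) = m A + m B"
    and inv: "\<And>x A. \<lbrakk>x \<in> carrier G; A \<subseteq> carrier G\<rbrakk> \<Longrightarrow> m (x <#\<^bsub>G\<^esub> A) = m A"
    by simp_all
  \<comment> \<open>The mean is pushed forward: a subset of \<open>carrier H\<close> is measured by
    its preimage in \<open>carrier G\<close>.\<close>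
  let ?p = "\<lambda>A. {x \<in> carrier G. h x \<in> A}"
  have "m (?p (y <#\<^bsub>H\<^esub> A)) = m (?p A)" if yA: "y \<in> carrier H" "A \<subseteq> carrier H" for y A
  proof -
    obtain x where x: "x \<in> carrier G" "y = h x"
      using yA(1) by (rule carrier_cases)
    have "?p (y <#\<^bsub>H\<^esub> A) = x <#\<^bsub>G\<^esub> ?p A"
    proof (intro equalityI subsetI)
      fix z assume "z \<in> ?p (y <#\<^bsub>H\<^esub> A)"
      then obtain a where z: "z \<in> carrier G" "a \<in> A" "h z = h x \<otimes>\<^bsub>H\<^esub> a"
        unfolding l_coset_def x(2) by blast
      then obtain b where b: "b \<in> carrier G" "a = h b"
        using yA(2) image_carrier by blast
      then have "h z = h (x \<otimes>\<^bsub>G\<^esub> b)"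
        using z(3) x(1) by simp
      then have "z = x \<otimes>\<^bsub>G\<^esub> b"
        using h_eq_iff[OF z(1), of "x \<otimes>\<^bsub>G\<^esub> b"] b(1) x(1) by blast
      then show "z \<in> x <#\<^bsub>G\<^esub> ?p A"
        unfolding l_coset_def using b z(2) by blast
    next
      fix z assume "z \<in> x <#\<^bsub>G\<^esub> ?p A"
      then obtain b where "b \<in> carrier G" "h b \<in> A" "z = x \<otimes>\<^bsub>G\<^esub> b"
        unfolding l_coset_def by blast
      then show "z \<in> ?p (y <#\<^bsub>H\<^esub> A)"
        unfolding l_coset_def x(2) using x(1) by auto
    qed
    moreover have "m (x <#\<^bsub>G\<^esub> ?p A) = m (?p A)"
      using x(1) by (rule inv) auto
    ultimately show ?thesis
      by simp
  qed
  moreover have "m (?p (A \<union> B)) = m (?p A) + m (?p B)" if "A \<inter> B = {}" for A B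
  proof -
    have "?p (A \<union> B) = ?p A \<union> ?p B"
      by auto
    moreover have "m (?p A \<union> ?p B) = m (?p A) + m (?p B)"
      by (rule add) (use that in auto)
    ultimately show ?thesis
      by simp
  qed
  moreover have "?p (carrier H) = carrier G"
    by auto
  moreover have "0 \<le> m (?p A)" for A
    by (rule nonneg) auto
  ultimately show ?thesis
    unfolding amenable_def using one by (intro exI[of _ "\<lambda>A. m (?p A)"]) simp
qed

lemma translate_dist_iso:
  assumes "prob_on G \<mu>" "x \<in> carrier G"
  shows "translate_dist H (h x) (map_pmf h \<mu>) = translate_dist G x \<mu>"
proof -
  have "translate_dist H (h x) (map_pmf h \<mu>)
    = (\<Sum>\<^sub>\<infinity>z\<in>carrier G. \<bar>pmf (map_pmf h \<mu>) (inv\<^bsub>H\<^esub> h x \<otimes>\<^bsub>H\<^esub> h z) - pmf (map_pmf h \<mu>) (h z)\<bar>)"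
    unfolding translate_dist_def by (rule infsum_reindex_bij_betw[OF bij, symmetric])
  also have "\<dots> = translate_dist G x \<mu>"
    unfolding translate_dist_def
  proof (rule infsum_cong)
    fix z assume z: "z \<in> carrier G"
    have "inv\<^bsub>H\<^esub> h x \<otimes>\<^bsub>H\<^esub> h z = h (inv\<^bsub>G\<^esub> x \<otimes>\<^bsub>G\<^esub> z)"
      using z assms(2) by simp
    then show "\<bar>pmf (map_pmf h \<mu>) (inv\<^bsub>H\<^esub> h x \<otimes>\<^bsub>H\<^esub> h z) - pmf (map_pmf h \<mu>) (h z)\<bar>
      = \<bar>pmf \<mu> (inv\<^bsub>G\<^esub> x \<otimes>\<^bsub>G\<^esub> z) - pmf \<mu> z\<bar>"
      using z assms by (simp only: pmf_map_iso G.m_closed G.inv_closed)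
  qed
  finally show ?thesis .
qed

lemma amenable_case_iso:
  assumes "amenable_case G M"
  shows "amenable_case H (\<lambda>n. map_pmf h (M n))"
proof -
  have M: "\<And>n. prob_on G (M n)" "almost_invariant G M" "amenable G"
    using assms by (auto simp: amenable_case_def)
  have "almost_invariant H (\<lambda>n. map_pmf h (M n))"
    unfolding almost_invariant_def
  proof
    fix y assume "y \<in> carrier H"
    then obtain x where x: "x \<in> carrier G" "y = h x"
      by (rule carrier_cases)
    show "(\<lambda>n. translate_dist H y (map_pmf h (M n))) \<longlonglongrightarrow> 0"
      using M(2) x unfolding almost_invariant_def by (simp add: translate_dist_iso[OF M(1)])
  qed
  then show ?thesis
    unfolding amenable_case_def using M(1,3) prob_on_iso amenable_iso by blast
qed

lemma commutator_iso:
  "\<lbrakk>x \<in> carrier G; y \<in> carrier G\<rbrakk> \<Longrightarrow> commutator H (h x) (h y) = h (commutator G x y)"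
  by (simp add: commutator_def)

lemma simple_commutator_iso:
  "set xs \<subseteq> carrier G \<Longrightarrow> simple_commutator H (map h xs) = h (simple_commutator G xs)"
proof (induction xs rule: rev_induct)
  case (snoc x xs)
  then show ?case
    using G.simple_commutator_closed[of xs]
    by (cases "xs = []") (simp_all add: simple_commutator_snoc commutator_iso)
qed simp

lemma dc_iso:
  assumes "prob_on G \<mu>"
  shows "dc H k (map_pmf h \<mu>) = dc G k \<mu>"
  unfolding dc_def replicate_pmf_map
proof (rule measure_map_pmf_cong)
  fix xs assume "xs \<in> set_pmf (replicate_pmf (k + 1) \<mu>)"
  then have xs: "set xs \<subseteq> carrier G"
    using assms by (auto simp: set_replicate_pmf prob_on_def simp del: replicate_pmf.simps)
  then show "map h xs \<in> {xs. simple_commutator H xs = \<one>\<^bsub>H\<^esub>} \<longleftrightarrow> xs \<in> {xs. simple_commutator G xs = \<one>\<^bsub>G\<^esub>}"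
    using h_eq_iff[OF G.simple_commutator_closed[OF xs] G.one_closed] by (simp add: simple_commutator_iso)
qed

lemma nilpotent_subgroup_iso:
  assumes K: "subgroup K H" "step_nilpotent k (H\<lparr>carrier := K\<rparr>)" "index_at_most H K C"
  defines "L \<equiv> {x \<in> carrier G. h x \<in> K}"
  shows "subgroup L G" "step_nilpotent k (G\<lparr>carrier := L\<rparr>)" "index_at_most G L C"
proof -
  show L: "subgroup L G"
  proof (rule subgroup.intro)
    show "x \<otimes>\<^bsub>G\<^esub> y \<in> L" if "x \<in> L" "y \<in> L" for x y
      using that K(1) by (simp add: L_def subgroup.m_closed)
    show "inv\<^bsub>G\<^esub> x \<in> L" if "x \<in> L" for x
      using that K(1) by (simp add: L_def subgroup.m_inv_closed)
  qed (use K(1) in \<open>auto simp: L_def subgroup.one_closed\<close>)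
  show "step_nilpotent k (G\<lparr>carrier := L\<rparr>)"
    unfolding step_nilpotent_def
  proof (intro allI impI)
    fix xs assume xs: "set xs \<subseteq> carrier (G\<lparr>carrier := L\<rparr>) \<and> length xs = k + 1"
    then have xsG: "set xs \<subseteq> carrier G" and xsL: "set xs \<subseteq> L" and xsK: "set (map h xs) \<subseteq> K"
      by (auto simp: L_def)
    have "simple_commutator (H\<lparr>carrier := K\<rparr>) (map h xs) = \<one>\<^bsub>H\<^esub>"
      using K(2) xsK xs unfolding step_nilpotent_def by simp
    then have "h (simple_commutator G xs) = h \<one>\<^bsub>G\<^esub>"
      using H.simple_commutator_subgroup[OF K(1) xsK] simple_commutator_iso[OF xsG] by simp
    then have "simple_commutator G xs = \<one>\<^bsub>G\<^esub>"
      using h_eq_iff[OF G.simple_commutator_closed[OF xsG] G.one_closed] by blast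
    then show "simple_commutator (G\<lparr>carrier := L\<rparr>) xs = \<one>\<^bsub>G\<lparr>carrier := L\<rparr>\<^esub>"
      using G.simple_commutator_subgroup[OF L xsL] by simp
  qed
  obtain c where c: "c \<in> carrier H \<rightarrow> {..<C}"
    "\<And>x y. \<lbrakk>x \<in> carrier H; y \<in> carrier H\<rbrakk> \<Longrightarrow> c x = c y \<longleftrightarrow> x \<otimes>\<^bsub>H\<^esub> inv\<^bsub>H\<^esub> y \<in> K"
    using H.index_at_most_labelling[OF K(1,3)] by metis
  show "index_at_most G L C"
  proof (rule G.index_at_mostI[OF L, where T = "{..<C}" and c = "\<lambda>x. c (h x)"])
    show "(\<lambda>x. c (h x)) ` carrier G \<subseteq> {..<C}"
      using c(1) by (intro image_subsetI) (auto intro: funcset_mem)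
    show "x \<otimes>\<^bsub>G\<^esub> inv\<^bsub>G\<^esub> y \<in> L" if "x \<in> carrier G" "y \<in> carrier G" "c (h x) = c (h y)" for x y
      using that c(2)[of "h x" "h y"] by (simp add: L_def)
  qed simp_all
qed

text \<open>Measures on \<open>G\<close> are pushed forward to \<open>H\<close>, which preserves
  both cases and the limit superior; the subgroup found in \<open>H\<close> is then pulled back to
  \<open>G\<close> with the same index bound.\<close>

lemma nilpotent_index_bound_iso:
  assumes "nilpotent_index_bound r k \<alpha> C H"
  shows "nilpotent_index_bound r k \<alpha> C G"
  unfolding nilpotent_index_bound_def
proof (intro impI allI)
  fix M assume G: "group G \<and> rank_at_most G r"
    and M: "(random_walk_case G M \<or> amenable_case G M) \<and> ereal \<alpha> \<le> dc_limsup G k M"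
  let ?M = "\<lambda>n. map_pmf h (M n)"
  have "prob_on G (M n)" for n
    using M G G.random_walk_case_detects_index(2) by (auto simp: amenable_case_def)
  then have "dc_limsup H k ?M = dc_limsup G k M"
    unfolding dc_limsup_def by (simp add: dc_iso)
  moreover have "random_walk_case H ?M \<or> amenable_case H ?M"
    using M random_walk_case_iso amenable_case_iso by blast
  ultimately obtain K where "subgroup K H" "step_nilpotent k (H\<lparr>carrier := K\<rparr>)" "index_at_most H K C"
    using assms M G rank_at_most_iso H.is_group unfolding nilpotent_index_bound_def by metis
  then show "\<exists>H. subgroup H G \<and> step_nilpotent k (G\<lparr>carrier := H\<rparr>) \<and> index_at_most G H C"
    using nilpotent_subgroup_iso by blast
qed

end

section \<open>Reduction to groups of natural numbers\<close>

lemma (in group) isomorphic_nat_group: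
  assumes "countable (carrier G)"
  obtains H :: "nat monoid" and h where "group_isomorphism G H h"
proof -
  obtain h :: "'a \<Rightarrow> nat" where h: "inj_on h (carrier G)"
    using assms unfolding countable_def by blast
  let ?H = "image_group h G"
  have iso: "h \<in> iso G ?H"
    using inj_imp_image_group_iso[OF h] .
  have "group ?H"
    using inj_imp_image_group_is_group[OF h] .
  then have "group_isomorphism G ?H h"
    using iso is_group
    by (simp add: group_isomorphism_def group_isomorphism_axioms_def group_hom_def
        group_hom_axioms_def iso_def)
  then show ?thesis
    by (rule that)
qed

theorem theorem1p6:
  fixes r k :: nat and \<alpha> :: real
  assumes "\<alpha> > 0"
  shows "(\<exists>C. \<forall>G :: nat monoid. nilpotent_index_bound r k \<alpha> C G) \<and>
         (\<forall>C. (\<forall>G :: nat monoid. nilpotent_index_bound r k \<alpha> C G) \<longrightarrow>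
              (\<forall>G :: 'a monoid. nilpotent_index_bound r k \<alpha> C G))"
proof (intro conjI exI allI impI)
  fix G :: "nat monoid"
  \<comment> \<open>The witness is built from \<open>r\<close>, \<open>k\<close> and \<alpha> alone,
    so it serves every \<open>G\<close>.\<close>
  show "nilpotent_index_bound r k \<alpha> (index_bound r k (\<alpha> / 2)) G"
  proof (cases "group G")
    case True
    then show ?thesis
      using group.index_bound_correct assms by blast
  qed (simp add: nilpotent_index_bound_def)
next
  fix C and G :: "'a monoid"
  assume nat: "\<forall>G :: nat monoid. nilpotent_index_bound r k \<alpha> C G"
  show "nilpotent_index_bound r k \<alpha> C G"
  proof (cases "group G \<and> rank_at_most G r")
    case True
    then interpret group G
      by blast
    obtain S where "S \<subseteq> carrier G" "finite S" "generate G S = carrier G"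
      using True unfolding rank_at_most_def by blast
    \<comment> \<open>Finite generation makes the carrier countable, so the group has an isomorphic
      copy on \<open>nat\<close>, to which the assumption on \<open>C\<close> applies.\<close>
    then have "countable (carrier G)"
      using countable_generate[of S] by (simp add: countable_finite)
    then obtain H :: "nat monoid" and h where "group_isomorphism G H h"
      by (rule isomorphic_nat_group)
    then show ?thesis
      using group_isomorphism.nilpotent_index_bound_iso nat by blast
  qed (auto simp: nilpotent_index_bound_def)
qed

end
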